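(* Consider the general rotational surfaces (in the sense of C. Moore) in $\mathbb R^4$ whose meridians lie in two-dimensional planes, $$M^2:\ z(u,v)=\left(f(u)\cos\alpha v,\;f(u)\sin\alpha v,\;g(u)\cos\beta v,\;g(u)\sin\beta v\right),\quad u\in J\subset\mathbb R,\ v\in[0,2\pi),$$ where $f,g$ are smooth functions with $\alpha^2f^2(u)+\beta^2g^2(u)>0$ and $f'^2(u)+g'^2(u)>0$ for $u\in J$, and $\alpha,\beta$ are positive constants. Without loss of generality let the meridian be given by $f=u$, $g=g(u)$. Then $$k=\frac{4\alpha^2\beta^2(g-ug')^2\,g''\,(\beta^2g-\alpha^2ug')}{(\alpha^2u^2+\beta^2g^2)^3(1+g'^2)^3},$$ and all such surfaces with $k=0$ are given by the following three cases: 1. $g(u)=au$, $a=\mathrm{const}\neq0$. In this case $k=\varkappa=K=0$, and $M^2$ is a developable surface in $\mathbb R^4$. 2. $g(u)=au+b$, $a=\mathrm{const}\neq0$, $b=\mathrm{const}\neq0$. In this case $k=0$, but $\varkappa\neq0$, $K\neq0$. Consequently, $M^2$ is a non-developable ruled surface in $\mathbb R^4$. 3. $g(u)=c\,u^{\beta^2/\alpha^2}$, $c=\mathrm{const}\neq0$. In case $\alpha\neq\beta$ one gets $k=0$, and $$\varkappa=\frac{c^2\alpha^{-5}\beta^3(\beta^2-\alpha^2)^2u^{2\frac{\beta^2-\alpha^2}{\alpha^2}}}{\left(\alpha^2u^2+\beta^2c^2u^{2\frac{\beta^2}{\alpha^2}}\right)\left(1+c^2\frac{\beta^4}{\alpha^4}u^{2\frac{\beta^2-\alpha^2}{\alpha^2}}\right)^2},$$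 $$K=-\frac{c^2\alpha^{-2}\beta^2(\beta^2-\alpha^2)^2u^{2\frac{\beta^2}{\alpha^2}}}{\left(\alpha^2u^2+\beta^2c^2u^{2\frac{\beta^2}{\alpha^2}}\right)^2\left(1+c^2\frac{\beta^4}{\alpha^4}u^{2\frac{\beta^2-\alpha^2}{\alpha^2}}\right)}.$$ Hence $\varkappa\neq0$, $K\neq0$. In this case the parametric lines $u=\mathrm{const}$ and $v=\mathrm{const}$ are not straight lines.
   Context: For a smooth regular surface $z=z(u,v)$ in Euclidean $\mathbb R^4$: $E,F,G$ are the coefficients of the first fundamental form, $W=\sqrt{EG-F^2}$, and $K$ is the Gauss curvature. $\{e_1,e_2\}$ is an orthonormal normal frame field chosen so that $\{z_u,z_v,e_1,e_2\}$ is positively oriented in $\mathbb R^4$. $\sigma$ is the vector-valued second fundamental tensor (normal part of the second derivative). The oriented area of the parallelogram of an ordered pair of normal vectors is $S(a^1e_1+a^2e_2,\;b^1e_1+b^2e_2)=a^1b^2-a^2b^1$. Put $L=\frac{2}{W}S(\sigma(z_u,z_u),\sigma(z_u,z_v))$, $M=\frac{1}{W}S(\sigma(z_u,z_u),\sigma(z_v,z_v))$, $N=\frac{2}{W}S(\sigma(z_u,z_v),\sigma(z_v,z_v))$. The invariants are $$k=\frac{LN-M^2}{EG-F^2},\qquad \varkappa=\frac{EN+GL-2FM}{2(EG-F^2)}.$$ The meridians of $M^2$ are the parametric curves $v=\mathrm{const}$. A ruled surface is one swept out by straight line segments (rulings); it is developable if its tangent plane is constant along each ruling.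
   Formalization: Constant g also gives k=0 (e.g. g=1), so it is added as a further case of the classification; in case 2, ϰ can vanish on one parallel, so ϰ≠0 is stated as not identically zero and nonzero exactly where a(β²−α²)u+β²b≠0. *)

theory Defs
  imports "HOL-Analysis.Analysis"
begin

text \<open>
  A parametrized surface is a map \<open>z\<close> of two real parameters \<open>u\<close>, \<open>v\<close>. The pointwise notions
  below depend only on the germ of \<open>z\<close> at \<open>(u, v)\<close>.
\<close>

definition smooth_on :: "real set \<Rightarrow> (real \<Rightarrow> real) \<Rightarrow> bool" where
  "smooth_on J f \<longleftrightarrow> (\<forall>n. (deriv ^^ n) f differentiable_on J)"

definition du :: "(real \<Rightarrow> real \<Rightarrow> 'a::real_normed_vector) \<Rightarrow> real \<Rightarrow> real \<Rightarrow> 'a" where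
  "du h u v = vector_derivative (\<lambda>x. h x v) (at u)"

definition dv :: "(real \<Rightarrow> real \<Rightarrow> 'a::real_normed_vector) \<Rightarrow> real \<Rightarrow> real \<Rightarrow> 'a" where
  "dv h u v = vector_derivative (\<lambda>y. h u y) (at v)"

subsection \<open>First fundamental form\<close>

definition ff_E :: "(real \<Rightarrow> real \<Rightarrow> real^4) \<Rightarrow> real \<Rightarrow> real \<Rightarrow> real" where
  "ff_E z u v = du z u v \<bullet> du z u v"

definition ff_F :: "(real \<Rightarrow> real \<Rightarrow> real^4) \<Rightarrow> real \<Rightarrow> real \<Rightarrow> real" where
  "ff_F z u v = du z u v \<bullet> dv z u v"

definition ff_G :: "(real \<Rightarrow> real \<Rightarrow> real^4) \<Rightarrow> real \<Rightarrow> real \<Rightarrow> real" where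
  "ff_G z u v = dv z u v \<bullet> dv z u v"

definition ff_W :: "(real \<Rightarrow> real \<Rightarrow> real^4) \<Rightarrow> real \<Rightarrow> real \<Rightarrow> real" where
  "ff_W z u v = sqrt (ff_E z u v * ff_G z u v - (ff_F z u v)\<^sup>2)"

subsection \<open>Gauss curvature\<close>

text \<open>
  The Gauss curvature is the sectional curvature of the induced metric, computed from the
  Levi-Civita connection. Index 1 stands for \<open>u\<close>, index 2 for \<open>v\<close>.
\<close>

definition partial :: "2 \<Rightarrow> (real \<Rightarrow> real \<Rightarrow> real) \<Rightarrow> real \<Rightarrow> real \<Rightarrow> real" where
  "partial i h = (if i = 1 then du h else dv h)"

definition metric :: "(real \<Rightarrow> real \<Rightarrow> real^4) \<Rightarrow> real \<Rightarrow> real \<Rightarrow> real^2^2" where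
  "metric z u v = vector [vector [ff_E z u v, ff_F z u v], vector [ff_F z u v, ff_G z u v]]"

definition christoffel :: "(real \<Rightarrow> real \<Rightarrow> real^4) \<Rightarrow> 2 \<Rightarrow> 2 \<Rightarrow> 2 \<Rightarrow> real \<Rightarrow> real \<Rightarrow> real" where
  "christoffel z l i j u v =
     (\<Sum>m\<in>UNIV. matrix_inv (metric z u v) $ l $ m *
        (partial i (\<lambda>u v. metric z u v $ j $ m) u v
         + partial j (\<lambda>u v. metric z u v $ i $ m) u v
         - partial m (\<lambda>u v. metric z u v $ i $ j) u v)) / 2"

text \<open>
  \<open>riemann z l k i j\<close> is the component along \<open>\<partial>\<^sub>l\<close> of
  \<open>R(\<partial>\<^sub>i, \<partial>\<^sub>j)\<partial>\<^sub>k\<close>, where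
  \<open>R(X, Y)Z = \<nabla>\<^sub>X \<nabla>\<^sub>Y Z - \<nabla>\<^sub>Y \<nabla>\<^sub>X Z - \<nabla>\<^bsub>[X, Y]\<^esub> Z\<close>.
\<close>

definition riemann :: "(real \<Rightarrow> real \<Rightarrow> real^4) \<Rightarrow> 2 \<Rightarrow> 2 \<Rightarrow> 2 \<Rightarrow> 2 \<Rightarrow> real \<Rightarrow> real \<Rightarrow> real" where
  "riemann z l k i j u v =
     partial i (christoffel z l j k) u v - partial j (christoffel z l i k) u v
     + (\<Sum>m\<in>UNIV. christoffel z l i m u v * christoffel z m j k u v
                   - christoffel z l j m u v * christoffel z m i k u v)"

definition gauss_curvature :: "(real \<Rightarrow> real \<Rightarrow> real^4) \<Rightarrow> real \<Rightarrow> real \<Rightarrow> real" where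
  "gauss_curvature z u v =
     (\<Sum>l\<in>UNIV. metric z u v $ 1 $ l * riemann z l 2 1 2 u v)
     / (ff_E z u v * ff_G z u v - (ff_F z u v)\<^sup>2)"

subsection \<open>Normal frame and second fundamental tensor\<close>

definition oriented_normal_frame ::
    "(real \<Rightarrow> real \<Rightarrow> real^4) \<Rightarrow> (real \<Rightarrow> real \<Rightarrow> real^4) \<Rightarrow> (real \<Rightarrow> real \<Rightarrow> real^4)
      \<Rightarrow> real \<Rightarrow> real \<Rightarrow> bool" where
  "oriented_normal_frame z e1 e2 u v \<longleftrightarrow>
     norm (e1 u v) = 1 \<and> norm (e2 u v) = 1 \<and> orthogonal (e1 u v) (e2 u v) \<and>
     (\<forall>e\<in>{e1 u v, e2 u v}. orthogonal e (du z u v) \<and> orthogonal e (dv z u v)) \<and>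
     det (vector [du z u v, dv z u v, e1 u v, e2 u v] :: real^4^4) > 0"

definition normal_part :: "(real \<Rightarrow> real \<Rightarrow> real^4) \<Rightarrow> real \<Rightarrow> real \<Rightarrow> real^4 \<Rightarrow> real^4" where
  "normal_part z u v x =
     (THE n. orthogonal n (du z u v) \<and> orthogonal n (dv z u v) \<and>
             x - n \<in> span {du z u v, dv z u v})"

definition sigma_uu :: "(real \<Rightarrow> real \<Rightarrow> real^4) \<Rightarrow> real \<Rightarrow> real \<Rightarrow> real^4" where
  "sigma_uu z u v = normal_part z u v (du (du z) u v)"

definition sigma_uv :: "(real \<Rightarrow> real \<Rightarrow> real^4) \<Rightarrow> real \<Rightarrow> real \<Rightarrow> real^4" where
  "sigma_uv z u v = normal_part z u v (dv (du z) u v)"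

definition sigma_vv :: "(real \<Rightarrow> real \<Rightarrow> real^4) \<Rightarrow> real \<Rightarrow> real \<Rightarrow> real^4" where
  "sigma_vv z u v = normal_part z u v (dv (dv z) u v)"

text \<open>
  For normal vectors \<open>a\<close>, \<open>b\<close> and an orthonormal normal frame \<open>p\<close>, \<open>q\<close>, the coordinates of
  \<open>a\<close> and \<open>b\<close> are their inner products with \<open>p\<close> and \<open>q\<close>.
\<close>

definition oriented_area :: "real^4 \<Rightarrow> real^4 \<Rightarrow> real^4 \<Rightarrow> real^4 \<Rightarrow> real" where
  "oriented_area p q a b = (a \<bullet> p) * (b \<bullet> q) - (a \<bullet> q) * (b \<bullet> p)"

subsection \<open>The invariants\<close>

definition coef_L :: "(real \<Rightarrow> real \<Rightarrow> real^4) \<Rightarrow> (real \<Rightarrow> real \<Rightarrow> real^4) \<Rightarrow> (real \<Rightarrow> real \<Rightarrow> real^4)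
    \<Rightarrow> real \<Rightarrow> real \<Rightarrow> real" where
  "coef_L z e1 e2 u v =
     2 / ff_W z u v * oriented_area (e1 u v) (e2 u v) (sigma_uu z u v) (sigma_uv z u v)"

definition coef_M :: "(real \<Rightarrow> real \<Rightarrow> real^4) \<Rightarrow> (real \<Rightarrow> real \<Rightarrow> real^4) \<Rightarrow> (real \<Rightarrow> real \<Rightarrow> real^4)
    \<Rightarrow> real \<Rightarrow> real \<Rightarrow> real" where
  "coef_M z e1 e2 u v =
     1 / ff_W z u v * oriented_area (e1 u v) (e2 u v) (sigma_uu z u v) (sigma_vv z u v)"

definition coef_N :: "(real \<Rightarrow> real \<Rightarrow> real^4) \<Rightarrow> (real \<Rightarrow> real \<Rightarrow> real^4) \<Rightarrow> (real \<Rightarrow> real \<Rightarrow> real^4)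
    \<Rightarrow> real \<Rightarrow> real \<Rightarrow> real" where
  "coef_N z e1 e2 u v =
     2 / ff_W z u v * oriented_area (e1 u v) (e2 u v) (sigma_uv z u v) (sigma_vv z u v)"

definition inv_k :: "(real \<Rightarrow> real \<Rightarrow> real^4) \<Rightarrow> (real \<Rightarrow> real \<Rightarrow> real^4) \<Rightarrow> (real \<Rightarrow> real \<Rightarrow> real^4)
    \<Rightarrow> real \<Rightarrow> real \<Rightarrow> real" where
  "inv_k z e1 e2 u v =
     (coef_L z e1 e2 u v * coef_N z e1 e2 u v - (coef_M z e1 e2 u v)\<^sup>2)
     / (ff_E z u v * ff_G z u v - (ff_F z u v)\<^sup>2)"

definition inv_kappa :: "(real \<Rightarrow> real \<Rightarrow> real^4) \<Rightarrow> (real \<Rightarrow> real \<Rightarrow> real^4) \<Rightarrow> (real \<Rightarrow> real \<Rightarrow> real^4)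
    \<Rightarrow> real \<Rightarrow> real \<Rightarrow> real" where
  "inv_kappa z e1 e2 u v =
     (ff_E z u v * coef_N z e1 e2 u v + ff_G z u v * coef_L z e1 e2 u v
      - 2 * ff_F z u v * coef_M z e1 e2 u v)
     / (2 * (ff_E z u v * ff_G z u v - (ff_F z u v)\<^sup>2))"

subsection \<open>Ruled and developable surfaces\<close>

text \<open>
  The surface is \<open>z\<close> on the parameter domain \<open>D\<close>. It need not be injective on \<open>D\<close>, so a ruling
  is given in \<open>D\<close>: a differentiable curve \<open>\<gamma>\<close> on an open interval \<open>I\<close>, sent by \<open>z\<close> to a
  nondegenerate straight segment with its affine parametrization.
\<close>

definition ruling :: "(real \<Rightarrow> real \<Rightarrow> real^4) \<Rightarrow> (real \<times> real) set
    \<Rightarrow> (real \<Rightarrow> real \<times> real) \<Rightarrow> real set \<Rightarrow> bool" where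
  "ruling z D \<gamma> I \<longleftrightarrow>
     open I \<and> is_interval I \<and> I \<noteq> {} \<and> \<gamma> differentiable_on I \<and> \<gamma> ` I \<subseteq> D \<and>
     (\<exists>p d. d \<noteq> 0 \<and> (\<forall>t\<in>I. case_prod z (\<gamma> t) = p + t *\<^sub>R d))"

definition swept_out_by :: "(real \<Rightarrow> real \<Rightarrow> real^4) \<Rightarrow> (real \<times> real) set
    \<Rightarrow> ((real \<Rightarrow> real \<times> real) \<times> real set) set \<Rightarrow> bool" where
  "swept_out_by z D R \<longleftrightarrow>
     (\<forall>(\<gamma>, I)\<in>R. ruling z D \<gamma> I) \<and> (\<Union>(\<gamma>, I)\<in>R. \<gamma> ` I) = D"

definition tangent_plane :: "(real \<Rightarrow> real \<Rightarrow> real^4) \<Rightarrow> real \<times> real \<Rightarrow> (real^4) set" where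
  "tangent_plane z q =
     (+) (case_prod z q) ` span {case_prod (du z) q, case_prod (dv z) q}"

definition ruled_surface :: "(real \<Rightarrow> real \<Rightarrow> real^4) \<Rightarrow> (real \<times> real) set \<Rightarrow> bool" where
  "ruled_surface z D \<longleftrightarrow> (\<exists>R. swept_out_by z D R)"

definition developable_surface :: "(real \<Rightarrow> real \<Rightarrow> real^4) \<Rightarrow> (real \<times> real) set \<Rightarrow> bool" where
  "developable_surface z D \<longleftrightarrow>
     (\<exists>R. swept_out_by z D R \<and>
          (\<forall>(\<gamma>, I)\<in>R. \<forall>s\<in>I. \<forall>t\<in>I. tangent_plane z (\<gamma> s) = tangent_plane z (\<gamma> t)))"

subsection \<open>General rotational surfaces\<close>

definition rotational_surface ::
    "(real \<Rightarrow> real) \<Rightarrow> (real \<Rightarrow> real) \<Rightarrow> real \<Rightarrow> real \<Rightarrow> real \<Rightarrow> real \<Rightarrow> real^4" where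
  "rotational_surface f g \<alpha> \<beta> u v =
     vector [f u * cos (\<alpha> * v), f u * sin (\<alpha> * v), g u * cos (\<beta> * v), g u * sin (\<beta> * v)]"

text \<open>
  The third family of profiles is \<open>g u = c * \<bar>u\<bar> powr p\<close>; on the positive half-line this is
  \<open>c * u powr p\<close>. The absolute value gives the power a meaning on parameter intervals in
  the negative half-line, where \<open>powr\<close> is not the intended function.
\<close>

definition is_constant_profile :: "real set \<Rightarrow> (real \<Rightarrow> real) \<Rightarrow> bool" where
  "is_constant_profile J g \<longleftrightarrow> (\<exists>c. \<forall>u\<in>J. g u = c)"

definition is_linear_profile :: "real set \<Rightarrow> (real \<Rightarrow> real) \<Rightarrow> real \<Rightarrow> bool" where
  "is_linear_profile J g a \<longleftrightarrow> a \<noteq> 0 \<and> (\<forall>u\<in>J. g u = a * u)"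

definition is_affine_profile :: "real set \<Rightarrow> (real \<Rightarrow> real) \<Rightarrow> real \<Rightarrow> real \<Rightarrow> bool" where
  "is_affine_profile J g a b \<longleftrightarrow> a \<noteq> 0 \<and> b \<noteq> 0 \<and> (\<forall>u\<in>J. g u = a * u + b)"

definition is_power_profile :: "real set \<Rightarrow> (real \<Rightarrow> real) \<Rightarrow> real \<Rightarrow> real \<Rightarrow> real \<Rightarrow> bool" where
  "is_power_profile J g \<alpha> \<beta> c \<longleftrightarrow>
     c \<noteq> 0 \<and> (\<forall>u\<in>J. g u = c * \<bar>u\<bar> powr (\<beta>\<^sup>2 / \<alpha>\<^sup>2))"

end

theory Submission
  imports Defs
begin

text \<open>
  Let the meridian be the graph of \<open>g\<close>. In the orthonormal frame of \<open>\<real>\<^sup>4\<close> that turns with the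
  angles \<open>\<alpha>v\<close> and \<open>\<beta>v\<close>, the vectors \<open>z\<^sub>u\<close>, \<open>z\<^sub>v\<close> and all second derivatives of \<open>z\<close> have
  coordinates that depend only on \<open>u\<close>. Hence \<open>F = 0\<close>, and everything reduces to calculus with the
  single function \<open>g\<close>.

  The oriented area of the normal parts of \<open>x\<close> and \<open>y\<close> is \<open>det(z\<^sub>u, z\<^sub>v, x, y) / W\<close> whatever the
  positively oriented normal frame is (\<open>oriented_area_normal_part\<close>). So \<open>L\<close>, \<open>M\<close>, \<open>N\<close> are
  determinants of sparse coordinate matrices. Here \<open>M = 0\<close>, because \<open>z\<^sub>u\<close>, \<open>z\<^sub>u\<^sub>u\<close>, \<open>z\<^sub>v\<^sub>v\<close> lie in
  one plane, and \<open>L\<close>, \<open>N\<close> factor (\<open>coef_formulas\<close>). The Gauss curvature comes from the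
  Christoffel symbols of a metric \<open>E(u)du\<^sup>2 + G(u)dv\<^sup>2\<close>.

  Up to a positive factor, \<open>k\<close> is the product of \<open>A\<^sup>2\<close>, \<open>g''\<close> and \<open>B\<close>, where \<open>A = g - ug'\<close> and
  \<open>B = \<beta>\<^sup>2g - \<alpha>\<^sup>2ug'\<close>. The point in the classification is that \<open>k = 0\<close> holds only for the product,
  so that different factors could vanish on different parts of the interval. Where \<open>g'' \<noteq> 0\<close>, the
  derivative \<open>A' = -ug''\<close> shows that \<open>A\<close> cannot vanish on an interval, so \<open>B = 0\<close> and \<open>g\<close> is a
  power function on each component of \<open>{g'' \<noteq> 0}\<close>. Passing to the limit at an end point of such a
  component, the power function still has \<open>g'' \<noteq> 0\<close> there, so the component has no end point
  inside the interval and is all of it (\<open>power_if_second_deriv_nonzero\<close>). Hence either \<open>g\<close> is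
  affine throughout, or it is a power function throughout.

  For the affine profile the surface must fail to be developable for every choice of rulings, not
  only for the meridians. If the tangent plane is constant along a ruling, then the normal vector
  with coordinates \<open>(0, \<beta>g, 0, -\<alpha>u)\<close> at one of its points stays normal along it. Differentiating this
  forces the velocity of the ruling in the parameter plane to vanish, which is absurd
  (\<open>affine_not_developable\<close>).
\<close>

section \<open>Oriented areas of normal vectors\<close>

lemma vector_4:
  "(vector [a, b, c, d] :: 'a::zero^4) $ 1 = a"
  "(vector [a, b, c, d] :: 'a::zero^4) $ 2 = b"
  "(vector [a, b, c, d] :: 'a::zero^4) $ 3 = c"
  "(vector [a, b, c, d] :: 'a::zero^4) $ 4 = d"
  unfolding vector_def by simp_all

lemma inner_4: "(x::real^4) \<bullet> y = x$1 * y$1 + x$2 * y$2 + x$3 * y$3 + x$4 * y$4"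
  by (simp add: inner_vec_def sum_4)

lemma det_4:
  "det (A::'a::comm_ring_1^4^4) =
     A$1$1 * (A$2$2 * (A$3$3 * A$4$4 - A$3$4 * A$4$3)
            - A$2$3 * (A$3$2 * A$4$4 - A$3$4 * A$4$2)
            + A$2$4 * (A$3$2 * A$4$3 - A$3$3 * A$4$2))
   - A$1$2 * (A$2$1 * (A$3$3 * A$4$4 - A$3$4 * A$4$3)
            - A$2$3 * (A$3$1 * A$4$4 - A$3$4 * A$4$1)
            + A$2$4 * (A$3$1 * A$4$3 - A$3$3 * A$4$1))
   + A$1$3 * (A$2$1 * (A$3$2 * A$4$4 - A$3$4 * A$4$2)
            - A$2$2 * (A$3$1 * A$4$4 - A$3$4 * A$4$1)
            + A$2$4 * (A$3$1 * A$4$2 - A$3$2 * A$4$1))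
   - A$1$4 * (A$2$1 * (A$3$2 * A$4$3 - A$3$3 * A$4$2)
            - A$2$2 * (A$3$1 * A$4$3 - A$3$3 * A$4$1)
            + A$2$3 * (A$3$1 * A$4$2 - A$3$2 * A$4$1))"
proof -
  have f1234: "finite {2::4, 3, 4}" "1 \<notin> {2::4, 3, 4}" by auto
  have f234: "finite {3::4, 4}" "2 \<notin> {3::4, 4}" by auto
  have f34: "finite {4::4}" "3 \<notin> {4::4}" by auto
  show ?thesis
    unfolding det_def UNIV_4
    unfolding sum_over_permutations_insert[OF f1234]
    unfolding sum_over_permutations_insert[OF f234]
    unfolding sum_over_permutations_insert[OF f34]
    unfolding permutes_sing
    by (simp add: sign_swap_id permutation_swap_id sign_compose sign_id swap_id_eq
        permutation_compose algebra_simps)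
qed

lemma matrix_inv_eqI:
  fixes A B :: "'a::semiring_1^'n^'n"
  assumes "A ** B = mat 1" "B ** A = mat 1"
  shows "matrix_inv A = B"
proof -
  have "A ** matrix_inv A = mat 1 \<and> matrix_inv A ** A = mat 1"
    unfolding matrix_inv_def by (rule someI[of _ B]) (use assms in simp)
  then show ?thesis
    by (metis assms(2) matrix_mul_assoc matrix_mul_lid matrix_mul_rid)
qed

text \<open>
  The vector \<open>x\<close> and its normal part differ by a tangent vector, so a normal vector does not
  distinguish them. This makes the coordinates of \<open>\<sigma>\<close> in a normal frame computable without
  finding the normal parts. Existence and uniqueness of the orthogonal decomposition turn the
  definite description into an actual vector.
\<close>

lemma inner_normal_part:
  assumes "orthogonal e (du z u v)" "orthogonal e (dv z u v)"
  shows "normal_part z u v x \<bullet> e = x \<bullet> e"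
proof -
  let ?T = "{du z u v, dv z u v}"
  let ?P = "\<lambda>n. orthogonal n (du z u v) \<and> orthogonal n (dv z u v) \<and> x - n \<in> span ?T"
  obtain y n where yn: "y \<in> span ?T" "\<And>w. w \<in> span ?T \<Longrightarrow> orthogonal n w" "x = y + n"
    using orthogonal_subspace_decomp_exists[of ?T x] by blast
  have P: "?P n"
    using yn by (simp add: span_base)
  have uniq: "m = n" if m: "?P m" for m
  proof -
    have "n - m = (x - m) - (x - n)" by simp
    then have mem: "n - m \<in> span ?T" using P m span_diff by metis
    have "orthogonal (n - m) w" if "w \<in> ?T" for w
      using that P m by (auto simp: orthogonal_clauses)
    then have "orthogonal (n - m) (n - m)" using mem orthogonal_to_span by blast
    then show ?thesis by (simp add: orthogonal_self)
  qed
  have "normal_part z u v x = n"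
    unfolding normal_part_def using P uniq by (rule the_equality)
  moreover have "orthogonal e y"
    using yn(1) by (rule orthogonal_to_span) (use assms in auto)
  then have "y \<bullet> e = 0" by (simp add: orthogonal_def inner_commute)
  ultimately show ?thesis using yn(3) by (simp add: inner_add_left)
qed

lemma rows_mult_transpose: "(A ** transpose B) $ i $ j = A $ i \<bullet> (B::real^'n^'m) $ j"
  by (simp add: matrix_matrix_mult_def transpose_def inner_vec_def)

text \<open>
  Multiply the matrix \<open>A\<close> with rows \<open>a, b, p, q\<close> by the transpose of the matrix with rows
  \<open>a, b, x, y\<close>. The entries are inner products, and the result is block triangular with diagonal
  blocks the Gram matrix of \<open>a, b\<close> (of determinant \<open>W\<^sup>2\<close>) and the coordinates of \<open>x, y\<close> in
  \<open>p, q\<close>. The case \<open>x = p\<close>, \<open>y = q\<close> and the orientation give \<open>det A = W\<close>, which is where the sign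
  is decided.
\<close>

lemma oriented_area_det:
  fixes a b p q x y :: "real^4"
  assumes n: "norm p = 1" "norm q = 1" "p \<bullet> q = 0"
    and o: "p \<bullet> a = 0" "p \<bullet> b = 0" "q \<bullet> a = 0" "q \<bullet> b = 0"
    and pos: "det (vector [a, b, p, q] :: real^4^4) > 0"
  defines "W \<equiv> sqrt ((a \<bullet> a) * (b \<bullet> b) - (a \<bullet> b)\<^sup>2)"
  shows "W > 0" and "W * oriented_area p q x y = det (vector [a, b, x, y] :: real^4^4)"
proof -
  let ?A = "vector [a, b, p, q] :: real^4^4"
  let ?B = "vector [a, b, x, y] :: real^4^4"
  let ?D = "(a \<bullet> a) * (b \<bullet> b) - (a \<bullet> b)\<^sup>2"
  have pp: "p \<bullet> p = 1" "q \<bullet> q = 1" using n(1,2) by (simp_all add: norm_eq_1)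
  note comm = inner_commute[of a p] inner_commute[of b p] inner_commute[of a q]
    inner_commute[of b q] inner_commute[of q p] inner_commute[of b a]
  have "det ?A * det ?A = det (?A ** transpose ?A)" by (simp add: det_mul det_transpose)
  also have "\<dots> = ?D"
    by (simp add: det_4 rows_mult_transpose vector_4 n(3) o pp comm power2_eq_square)
  finally have AA: "det ?A * det ?A = ?D" .
  then have "det ?A = W" using pos unfolding W_def by (metis abs_of_pos real_sqrt_abs2)
  then show "W > 0" using pos by simp
  have "det ?A * det ?B = det (?A ** transpose ?B)" by (simp add: det_mul det_transpose)
  also have "\<dots> = ?D * oriented_area p q x y"
    by (simp add: det_4 rows_mult_transpose vector_4 n(3) o pp comm power2_eq_square
        oriented_area_def inner_commute[of x] inner_commute[of y] algebra_simps)
  finally have "W * det ?B = W * (W * oriented_area p q x y)"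
    using AA \<open>det ?A = W\<close> by (simp add: mult.assoc)
  then show "W * oriented_area p q x y = det ?B" using \<open>W > 0\<close> by simp
qed

lemma oriented_area_normal_part:
  assumes "oriented_normal_frame z e1 e2 u v"
  shows "ff_W z u v > 0"
    and "oriented_area (e1 u v) (e2 u v) (normal_part z u v x) (normal_part z u v y) =
           det (vector [du z u v, dv z u v, x, y] :: real^4^4) / ff_W z u v"
proof -
  note fr = assms[unfolded oriented_normal_frame_def]
  have W: "ff_W z u v = sqrt ((du z u v \<bullet> du z u v) * (dv z u v \<bullet> dv z u v) - (du z u v \<bullet> dv z u v)\<^sup>2)"
    by (simp add: ff_W_def ff_E_def ff_F_def ff_G_def)
  show pos: "ff_W z u v > 0"
    unfolding W by (rule oriented_area_det[where p = "e1 u v" and q = "e2 u v"])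
      (use fr in \<open>auto simp: orthogonal_def\<close>)
  have "ff_W z u v * oriented_area (e1 u v) (e2 u v) x y =
      det (vector [du z u v, dv z u v, x, y] :: real^4^4)"
    unfolding W by (rule oriented_area_det) (use fr in \<open>auto simp: orthogonal_def\<close>)
  moreover have "oriented_area (e1 u v) (e2 u v) (normal_part z u v x) (normal_part z u v y) =
      oriented_area (e1 u v) (e2 u v) x y"
    unfolding oriented_area_def using fr by (simp add: inner_normal_part)
  ultimately show "oriented_area (e1 u v) (e2 u v) (normal_part z u v x) (normal_part z u v y) =
           det (vector [du z u v, dv z u v, x, y] :: real^4^4) / ff_W z u v"
    using pos by (simp add: field_simps)
qed

section \<open>Partial derivatives and the rotating frame\<close>

lemma du_eqI:
  fixes h :: "real \<Rightarrow> real \<Rightarrow> 'a::real_normed_vector"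
  assumes "open J" "u \<in> J" "\<And>x. x \<in> J \<Longrightarrow> h x v = k x" "(k has_vector_derivative D) (at u)"
  shows "du h u v = D"
  unfolding du_def
  by (rule vector_derivative_at, rule has_vector_derivative_transform_within_open[OF assms(4,1,2)])
    (simp add: assms(3))

lemma dv_eqI:
  fixes h :: "real \<Rightarrow> real \<Rightarrow> 'a::real_normed_vector"
  assumes "\<And>y. h u y = k y" "(k has_vector_derivative D) (at v)"
  shows "dv h u v = D"
proof -
  have "h u = k" using assms(1) by blast
  then show ?thesis unfolding dv_def using assms(2) by (simp add: vector_derivative_at)
qed

lemma dv_const:
  assumes "\<And>y. h u y = c"
  shows "dv h u v = 0"
  using assms by (rule dv_eqI) simp

text \<open>
  The vector with coordinates \<open>(r, s, t, w)\<close> in the positively oriented orthonormal frame obtained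
  from the standard one by rotating the first plane by \<open>\<alpha>v\<close> and the second one by \<open>\<beta>v\<close>.
\<close>

definition rot_frame :: "real \<Rightarrow> real \<Rightarrow> real \<Rightarrow> real \<Rightarrow> real \<Rightarrow> real \<Rightarrow> real \<Rightarrow> real^4" where
  "rot_frame \<alpha> \<beta> v r s t w =
     vector [r * cos (\<alpha> * v) - s * sin (\<alpha> * v), r * sin (\<alpha> * v) + s * cos (\<alpha> * v),
             t * cos (\<beta> * v) - w * sin (\<beta> * v), t * sin (\<beta> * v) + w * cos (\<beta> * v)]"

lemma has_vector_derivative_vector_4:
  assumes "(a has_real_derivative a') (at t)" "(b has_real_derivative b') (at t)"
    "(c has_real_derivative c') (at t)" "(d has_real_derivative d') (at t)"
  shows "((\<lambda>x. vector [a x, b x, c x, d x] :: real^4) has_vector_derivative vector [a', b', c', d']) (at t)"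
proof -
  have "\<forall>i. ((\<lambda>x. (vector [a x, b x, c x, d x] :: real^4) $ i) has_derivative
      (\<lambda>x. x * (vector [a', b', c', d'] :: real^4) $ i)) (at t)"
    using assms[unfolded has_real_derivative_iff_has_vector_derivative has_vector_derivative_def]
    by (simp add: forall_4 vector_4)
  then show ?thesis
    unfolding has_vector_derivative_def
    by (subst has_derivative_componentwise_within) (auto simp: Basis_vec_def inner_axis)
qed

text \<open>
  Product rule in the rotating frame: the frame itself turns with angular velocities \<open>\<alpha>y'\<close> and
  \<open>\<beta>y'\<close>. The angle is allowed to vary along a curve, so that the same rule gives the partial
  derivatives of the surface and the derivatives along an arbitrary ruling.
\<close>

lemma rot_frame_has_vector_derivative:
  assumes "(y has_real_derivative y') (at x)"
    "(r has_real_derivative r') (at x)" "(s has_real_derivative s') (at x)"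
    "(t has_real_derivative t') (at x)" "(w has_real_derivative w') (at x)"
  shows "((\<lambda>x. rot_frame \<alpha> \<beta> (y x) (r x) (s x) (t x) (w x)) has_vector_derivative
     rot_frame \<alpha> \<beta> (y x) (r' - \<alpha> * y' * s x) (s' + \<alpha> * y' * r x)
       (t' - \<beta> * y' * w x) (w' + \<beta> * y' * t x)) (at x)"
proof -
  have eq: "rot_frame \<alpha> \<beta> (y x) (r' - \<alpha> * y' * s x) (s' + \<alpha> * y' * r x)
       (t' - \<beta> * y' * w x) (w' + \<beta> * y' * t x) =
    vector [r' * cos (\<alpha> * y x) - r x * (sin (\<alpha> * y x) * (\<alpha> * y')) - (s' * sin (\<alpha> * y x) + s x * (cos (\<alpha> * y x) * (\<alpha> * y'))),
      r' * sin (\<alpha> * y x) + r x * (cos (\<alpha> * y x) * (\<alpha> * y')) + (s' * cos (\<alpha> * y x) - s x * (sin (\<alpha> * y x) * (\<alpha> * y'))),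
      t' * cos (\<beta> * y x) - t x * (sin (\<beta> * y x) * (\<beta> * y')) - (w' * sin (\<beta> * y x) + w x * (cos (\<beta> * y x) * (\<beta> * y'))),
      t' * sin (\<beta> * y x) + t x * (cos (\<beta> * y x) * (\<beta> * y')) + (w' * cos (\<beta> * y x) - w x * (sin (\<beta> * y x) * (\<beta> * y')))]"
    unfolding rot_frame_def by (simp add: algebra_simps)
  show ?thesis
    unfolding eq unfolding rot_frame_def
    by (rule has_vector_derivative_vector_4; (rule derivative_eq_intros assms refl | simp)+)
qed

lemma inner_rot_frame:
  "rot_frame \<alpha> \<beta> v r s t w \<bullet> rot_frame \<alpha> \<beta> v r' s' t' w' = r * r' + s * s' + t * t' + w * w'"
proof -
  have *: "(r * C - s * S) * (r' * C - s' * S) + (r * S + s * C) * (r' * S + s' * C) = r * r' + s * s'"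
    if "C\<^sup>2 + S\<^sup>2 = 1" for r s r' s' C S :: real
  proof -
    have "(r * C - s * S) * (r' * C - s' * S) + (r * S + s * C) * (r' * S + s' * C)
       = (r * r' + s * s') * (C\<^sup>2 + S\<^sup>2)" by algebra
    then show ?thesis using that by simp
  qed
  show ?thesis
    using *[of "cos (\<alpha> * v)" "sin (\<alpha> * v)" r s r' s'] *[of "cos (\<beta> * v)" "sin (\<beta> * v)" t w t' w']
    by (simp add: rot_frame_def inner_4 vector_4)
qed

text \<open>
  The rotating frame has determinant 1.
\<close>

lemma det_rot_frame:
  "det (vector [rot_frame \<alpha> \<beta> v a1 a2 a3 a4, rot_frame \<alpha> \<beta> v b1 b2 b3 b4,
                rot_frame \<alpha> \<beta> v c1 c2 c3 c4, rot_frame \<alpha> \<beta> v d1 d2 d3 d4] :: real^4^4) =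
   det (vector [vector [a1, a2, a3, a4], vector [b1, b2, b3, b4],
                vector [c1, c2, c3, c4], vector [d1, d2, d3, d4]] :: real^4^4)"
proof -
  let ?c = "cos (\<alpha> * v)" and ?s = "sin (\<alpha> * v)" and ?C = "cos (\<beta> * v)" and ?S = "sin (\<beta> * v)"
  let ?R = "vector [vector [?c, ?s, 0, 0], vector [- ?s, ?c, 0, 0],
                    vector [0, 0, ?C, ?S], vector [0, 0, - ?S, ?C]] :: real^4^4"
  let ?M = "vector [vector [a1, a2, a3, a4], vector [b1, b2, b3, b4],
                vector [c1, c2, c3, c4], vector [d1, d2, d3, d4]] :: real^4^4"
  have "det ?R = (?c * ?c + ?s * ?s) * (?C * ?C + ?S * ?S)"
    by (simp add: det_4 vector_4 algebra_simps)
  then have R: "det ?R = 1"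
    by (simp flip: power2_eq_square)
  have "vector [rot_frame \<alpha> \<beta> v a1 a2 a3 a4, rot_frame \<alpha> \<beta> v b1 b2 b3 b4,
                rot_frame \<alpha> \<beta> v c1 c2 c3 c4, rot_frame \<alpha> \<beta> v d1 d2 d3 d4] = ?M ** ?R"
    by (simp add: vec_eq_iff forall_4 vector_4 matrix_matrix_mult_def sum_4 rot_frame_def)
  then show ?thesis using R by (simp add: det_mul)
qed

section \<open>Gauss curvature of a metric \<open>E(u)du\<^sup>2 + G(u)dv\<^sup>2\<close>\<close>

locale warped_metric =
  fixes z :: "real \<Rightarrow> real \<Rightarrow> real^4" and J :: "real set" and E G E' G' G'' :: "real \<Rightarrow> real"
  assumes open_J: "open J"
    and E: "\<And>u v. u \<in> J \<Longrightarrow> ff_E z u v = E u"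
    and F: "\<And>u v. u \<in> J \<Longrightarrow> ff_F z u v = 0"
    and G: "\<And>u v. u \<in> J \<Longrightarrow> ff_G z u v = G u"
    and E_pos: "\<And>u. u \<in> J \<Longrightarrow> E u > 0"
    and G_pos: "\<And>u. u \<in> J \<Longrightarrow> G u > 0"
    and E': "\<And>u. u \<in> J \<Longrightarrow> (E has_real_derivative E' u) (at u)"
    and G': "\<And>u. u \<in> J \<Longrightarrow> (G has_real_derivative G' u) (at u)"
    and G'': "\<And>u. u \<in> J \<Longrightarrow> (G' has_real_derivative G'' u) (at u)"
begin

lemma metric_entries:
  assumes "u \<in> J"
  shows "metric z u v $ 1 $ 1 = E u" "metric z u v $ 1 $ 2 = 0"
    "metric z u v $ 2 $ 1 = 0" "metric z u v $ 2 $ 2 = G u"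
  using assms by (simp_all add: metric_def E F G)

lemma metric_inv:
  assumes "u \<in> J"
  shows "matrix_inv (metric z u v) = vector [vector [1 / E u, 0], vector [0, 1 / G u]]"
  using E_pos[OF assms] G_pos[OF assms] assms
  by (intro matrix_inv_eqI)
    (simp_all add: vec_eq_iff forall_2 matrix_matrix_mult_def sum_2 metric_entries mat_def)

lemma du_metric:
  assumes "u \<in> J"
  shows "du (\<lambda>u v. metric z u v $ 1 $ 1) u v = E' u" "du (\<lambda>u v. metric z u v $ 1 $ 2) u v = 0"
    "du (\<lambda>u v. metric z u v $ 2 $ 1) u v = 0" "du (\<lambda>u v. metric z u v $ 2 $ 2) u v = G' u"
  using assms E'[OF assms] G'[OF assms]
    du_eqI[OF open_J assms, of "\<lambda>u v. metric z u v $ 1 $ 1" v E]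
    du_eqI[OF open_J assms, of "\<lambda>u v. metric z u v $ 1 $ 2" v "\<lambda>_. 0"]
    du_eqI[OF open_J assms, of "\<lambda>u v. metric z u v $ 2 $ 1" v "\<lambda>_. 0"]
    du_eqI[OF open_J assms, of "\<lambda>u v. metric z u v $ 2 $ 2" v G]
  by (simp_all add: metric_entries has_real_derivative_iff_has_vector_derivative)

lemma dv_metric:
  assumes "u \<in> J"
  shows "dv (\<lambda>u v. metric z u v $ i $ j) u v = 0"
proof -
  have "metric z u y $ i $ j = metric z u 0 $ i $ j" for y
    using assms by (simp add: metric_def E F G)
  then show ?thesis by (rule dv_const)
qed

lemma christoffel_values:
  assumes "u \<in> J"
  shows "christoffel z 1 1 1 u v = E' u / (2 * E u)" "christoffel z 1 2 2 u v = - G' u / (2 * E u)"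
    "christoffel z 1 1 2 u v = 0" "christoffel z 1 2 1 u v = 0"
    "christoffel z 2 1 1 u v = 0" "christoffel z 2 2 2 u v = 0"
    "christoffel z 2 1 2 u v = G' u / (2 * G u)" "christoffel z 2 2 1 u v = G' u / (2 * G u)"
  using assms
  by (simp_all add: christoffel_def partial_def metric_inv sum_2 du_metric dv_metric)

text \<open>
  Only \<open>R(\<partial>\<^sub>u, \<partial>\<^sub>v)\<partial>\<^sub>v\<close> along \<open>\<partial>\<^sub>u\<close> contributes, as the metric is diagonal; and since nothing
  depends on \<open>v\<close>, the only Christoffel symbol that has to be differentiated is
  \<open>\<Gamma>\<^sup>1\<^sub>2\<^sub>2 = -G'/(2E)\<close>.
\<close>

lemma gauss_curvature_formula:
  assumes u: "u \<in> J"
  shows "gauss_curvature z u v =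
    (- G'' u / (2 * E u) + E' u * G' u / (4 * (E u)\<^sup>2) + (G' u)\<^sup>2 / (4 * E u * G u)) / G u"
proof -
  have pos: "E u > 0" "G u > 0" using E_pos G_pos u by auto
  have "((\<lambda>u. - G' u / (2 * E u)) has_real_derivative
      (- G'' u * (2 * E u) + G' u * (2 * E' u)) / (2 * E u)\<^sup>2) (at u)"
    by (rule derivative_eq_intros G''[OF u] E'[OF u] refl | use pos in \<open>simp add: power2_eq_square\<close>)+
  then have "du (christoffel z 1 2 2) u v = (- G'' u * (2 * E u) + G' u * (2 * E' u)) / (2 * E u)\<^sup>2"
    using u by (intro du_eqI[OF open_J])
      (simp_all add: christoffel_values flip: has_real_derivative_iff_has_vector_derivative)
  moreover have "dv (christoffel z 1 1 2) u v = 0"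
    using u by (intro dv_const[of _ _ 0]) (simp add: christoffel_values)
  ultimately have "gauss_curvature z u v =
    E u * ((- G'' u * (2 * E u) + G' u * (2 * E' u)) / (2 * E u)\<^sup>2
      + E' u / (2 * E u) * (- G' u / (2 * E u)) + G' u / (2 * E u) * (G' u / (2 * G u))) / (E u * G u)"
    using u by (simp add: gauss_curvature_def riemann_def partial_def metric_entries sum_2
        christoffel_values E F G)
  also have "\<dots> = (- G'' u / (2 * E u) + E' u * G' u / (4 * (E u)\<^sup>2) + (G' u)\<^sup>2 / (4 * E u * G u)) / G u"
    using pos by (simp add: field_simps power2_eq_square)
  finally show ?thesis .
qed

end

section \<open>The surface over a meridian (u, g(u))\<close>

locale rotational_graph =
  fixes J :: "real set" and f g :: "real \<Rightarrow> real" and \<alpha> \<beta> :: real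
    and z :: "real \<Rightarrow> real \<Rightarrow> real^4"
  assumes J: "open J" "is_interval J" "J \<noteq> {}"
    and smooth: "smooth_on J g"
    and pos: "\<alpha> > 0" "\<beta> > 0"
    and regular: "\<And>u. u \<in> J \<Longrightarrow> \<alpha>\<^sup>2 * u\<^sup>2 + \<beta>\<^sup>2 * (g u)\<^sup>2 > 0"
    and z: "z = rotational_surface f g \<alpha> \<beta>"
    and meridian: "\<And>u. u \<in> J \<Longrightarrow> f u = u"
begin

lemma deriv_n:
  assumes "u \<in> J"
  shows "((deriv ^^ n) g has_real_derivative deriv ((deriv ^^ n) g) u) (at u)"
  using smooth assms J(1) unfolding smooth_on_def
  by (simp add: DERIV_deriv_iff_real_differentiable differentiable_on_eq_differentiable_at)

lemma g': "u \<in> J \<Longrightarrow> (g has_real_derivative deriv g u) (at u)"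
  using deriv_n[of u 0] by simp

lemma g'': "u \<in> J \<Longrightarrow> (deriv g has_real_derivative deriv (deriv g) u) (at u)"
  using deriv_n[of u 1] by simp

lemma isCont_g'': "u \<in> J \<Longrightarrow> isCont (deriv (deriv g)) u"
  using DERIV_isCont[OF deriv_n[of u 2]] by (simp add: numeral_2_eq_2)

lemma z_eq: "u \<in> J \<Longrightarrow> z u v = rot_frame \<alpha> \<beta> v u 0 (g u) 0"
  by (simp add: z rotational_surface_def rot_frame_def meridian)

lemma du_z: "u \<in> J \<Longrightarrow> du z u v = rot_frame \<alpha> \<beta> v 1 0 (deriv g u) 0"
  by (rule du_eqI[OF J(1)], assumption, erule z_eq, rule has_vector_derivative_eq_rhs,
      rule rot_frame_has_vector_derivative[OF DERIV_const DERIV_ident DERIV_const g' DERIV_const])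
    simp_all

lemma dv_z: "u \<in> J \<Longrightarrow> dv z u v = rot_frame \<alpha> \<beta> v 0 (\<alpha> * u) 0 (\<beta> * g u)"
  by (rule dv_eqI, erule z_eq, rule has_vector_derivative_eq_rhs,
      rule rot_frame_has_vector_derivative[OF DERIV_ident DERIV_const DERIV_const DERIV_const DERIV_const])
    simp_all

lemma du_du_z: "u \<in> J \<Longrightarrow> du (du z) u v = rot_frame \<alpha> \<beta> v 0 0 (deriv (deriv g) u) 0"
  by (rule du_eqI[OF J(1)], assumption, erule du_z, rule has_vector_derivative_eq_rhs,
      rule rot_frame_has_vector_derivative[OF DERIV_const DERIV_const DERIV_const g'' DERIV_const])
    simp_all

lemma dv_du_z: "u \<in> J \<Longrightarrow> dv (du z) u v = rot_frame \<alpha> \<beta> v 0 \<alpha> 0 (\<beta> * deriv g u)"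
  by (rule dv_eqI, erule du_z, rule has_vector_derivative_eq_rhs,
      rule rot_frame_has_vector_derivative[OF DERIV_ident DERIV_const DERIV_const DERIV_const DERIV_const])
    simp_all

lemma dv_dv_z: "u \<in> J \<Longrightarrow> dv (dv z) u v = rot_frame \<alpha> \<beta> v (- \<alpha>\<^sup>2 * u) 0 (- \<beta>\<^sup>2 * g u) 0"
  by (rule dv_eqI, erule dv_z, rule has_vector_derivative_eq_rhs,
      rule rot_frame_has_vector_derivative[OF DERIV_ident DERIV_const DERIV_const DERIV_const DERIV_const])
    (simp_all add: power2_eq_square algebra_simps)

definition EE :: "real \<Rightarrow> real" where "EE u = 1 + (deriv g u)\<^sup>2"
definition GG :: "real \<Rightarrow> real" where "GG u = \<alpha>\<^sup>2 * u\<^sup>2 + \<beta>\<^sup>2 * (g u)\<^sup>2"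

lemma EE_pos: "EE u > 0" by (simp add: EE_def add_pos_nonneg)
lemma GG_pos: "u \<in> J \<Longrightarrow> GG u > 0" by (simp add: GG_def regular)

lemma ff_values:
  assumes "u \<in> J"
  shows "ff_E z u v = EE u" "ff_F z u v = 0" "ff_G z u v = GG u"
  using assms by (simp_all add: ff_E_def ff_F_def ff_G_def du_z dv_z inner_rot_frame EE_def GG_def
      power2_eq_square algebra_simps)

text \<open>
  In the rotating frame \<open>z\<^sub>u\<close>, \<open>z\<^sub>u\<^sub>u\<close>, \<open>z\<^sub>v\<^sub>v\<close> have coordinates in the first and third position only,
  and \<open>z\<^sub>v\<close>, \<open>z\<^sub>u\<^sub>v\<close> in the second and fourth. Each determinant is therefore a product of two
  \<open>2\<times>2\<close> determinants or zero.
\<close>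

lemma coef_formulas:
  assumes u: "u \<in> J" and fr: "oriented_normal_frame z e1 e2 u v"
  shows "coef_L z e1 e2 u v =
      2 * \<alpha> * \<beta> * deriv (deriv g) u * (u * deriv g u - g u) / (EE u * GG u)"
    and "coef_M z e1 e2 u v = 0"
    and "coef_N z e1 e2 u v =
      2 * \<alpha> * \<beta> * (u * deriv g u - g u) * (\<beta>\<^sup>2 * g u - \<alpha>\<^sup>2 * u * deriv g u) / (EE u * GG u)"
proof -
  have W: "ff_W z u v = sqrt (EE u * GG u)" by (simp add: ff_W_def ff_values u)
  have W2: "ff_W z u v * ff_W z u v = EE u * GG u"
    unfolding W using EE_pos[of u] GG_pos[OF u] by simp
  have *: "c / ff_W z u v * (x / ff_W z u v) = c * x / (EE u * GG u)" for c x
    by (simp flip: W2)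
  note simps = sigma_uu_def sigma_uv_def sigma_vv_def oriented_area_normal_part(2)[OF fr]
      du_z[OF u] dv_z[OF u] du_du_z[OF u] dv_du_z[OF u] dv_dv_z[OF u] det_rot_frame
  show "coef_L z e1 e2 u v =
      2 * \<alpha> * \<beta> * deriv (deriv g) u * (u * deriv g u - g u) / (EE u * GG u)"
    unfolding coef_L_def simps unfolding det_4 vector_4 * by (simp add: algebra_simps)
  show "coef_M z e1 e2 u v = 0"
    unfolding coef_M_def simps unfolding det_4 vector_4 * by simp
  show "coef_N z e1 e2 u v =
      2 * \<alpha> * \<beta> * (u * deriv g u - g u) * (\<beta>\<^sup>2 * g u - \<alpha>\<^sup>2 * u * deriv g u) / (EE u * GG u)"
    unfolding coef_N_def simps unfolding det_4 vector_4 * by (simp add: algebra_simps)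
qed

lemma inv_k_formula:
  assumes u: "u \<in> J" and fr: "oriented_normal_frame z e1 e2 u v"
  shows "inv_k z e1 e2 u v =
        4 * \<alpha>\<^sup>2 * \<beta>\<^sup>2 * (g u - u * deriv g u)\<^sup>2 * deriv (deriv g) u
          * (\<beta>\<^sup>2 * g u - \<alpha>\<^sup>2 * u * deriv g u)
        / (GG u ^ 3 * EE u ^ 3)"
proof -
  define D where "D = u * deriv g u - g u"
  have D: "g u - u * deriv g u = - D" by (simp add: D_def)
  show ?thesis
    unfolding inv_k_def coef_formulas[OF u fr] ff_values[OF u] D D_def[symmetric]
    by (simp add: power2_eq_square power3_eq_cube mult_ac)
qed

lemma inv_kappa_formula:
  assumes u: "u \<in> J" and fr: "oriented_normal_frame z e1 e2 u v"
  shows "inv_kappa z e1 e2 u v =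
     \<alpha> * \<beta> * (u * deriv g u - g u) *
       (EE u * (\<beta>\<^sup>2 * g u - \<alpha>\<^sup>2 * u * deriv g u) + GG u * deriv (deriv g) u) / (EE u * GG u)\<^sup>2"
proof -
  have "EE u > 0" "GG u > 0" using EE_pos GG_pos u by auto
  then show ?thesis
    by (simp add: inv_kappa_def coef_formulas[OF u fr] ff_values u field_simps power2_eq_square)
qed

text \<open>
  The shape of the right-hand side is that of the Gauss equation: the square comes from
  \<open>\<sigma>(z\<^sub>u, z\<^sub>v)\<close>, the other term from the product of \<open>\<sigma>(z\<^sub>u, z\<^sub>u)\<close> and \<open>\<sigma>(z\<^sub>v, z\<^sub>v)\<close>.
  It displays the factors \<open>g - ug'\<close>, \<open>g''\<close>, \<open>\<beta>\<^sup>2g - \<alpha>\<^sup>2ug'\<close> of \<open>k\<close>, at least one of which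
  vanishes for each special profile.
\<close>

lemma gauss_curvature_eq:
  assumes u: "u \<in> J"
  shows "gauss_curvature z u v =
    - ((\<alpha> * \<beta> * (g u - u * deriv g u))\<^sup>2 * EE u
       + GG u * deriv (deriv g) u * (\<beta>\<^sup>2 * g u - \<alpha>\<^sup>2 * u * deriv g u)) / (EE u * GG u)\<^sup>2"
proof -
  define E' where "E' u = 2 * deriv g u * deriv (deriv g) u" for u
  define G' where "G' u = 2 * (\<alpha>\<^sup>2 * u + \<beta>\<^sup>2 * g u * deriv g u)" for u
  define G'' where "G'' u = 2 * (\<alpha>\<^sup>2 + \<beta>\<^sup>2 * (deriv g u)\<^sup>2 + \<beta>\<^sup>2 * g u * deriv (deriv g) u)" for u
  interpret warped_metric z J EE GG E' G' G''
  proof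
    fix u assume "u \<in> J"
    note d = g'[OF this] g''[OF this]
    show "(EE has_real_derivative E' u) (at u)"
      unfolding EE_def[abs_def] E'_def by (rule derivative_eq_intros d refl | simp)+
    show "(GG has_real_derivative G' u) (at u)"
      unfolding GG_def[abs_def] G'_def by (rule derivative_eq_intros d refl | simp)+
    show "(G' has_real_derivative G'' u) (at u)"
      unfolding G'_def[abs_def] G''_def
      by (rule derivative_eq_intros d refl | simp add: power2_eq_square algebra_simps)+
  qed (simp_all add: J ff_values EE_pos GG_pos)
  have p: "EE u > 0" "GG u > 0" using EE_pos GG_pos u by auto
  have "gauss_curvature z u v = (- G'' u / (2 * EE u) + E' u * G' u / (4 * (EE u)\<^sup>2)
      + (G' u)\<^sup>2 / (4 * EE u * GG u)) / GG u"
    using u by (rule gauss_curvature_formula)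
  also have "\<dots> = (- 2 * G'' u * EE u * GG u + E' u * G' u * GG u + (G' u)\<^sup>2 * EE u) / (4 * (EE u * GG u)\<^sup>2)"
    using p by (simp add: field_simps power2_eq_square)
  also have "- 2 * G'' u * EE u * GG u + E' u * G' u * GG u + (G' u)\<^sup>2 * EE u =
     - 4 * ((\<alpha> * \<beta> * (g u - u * deriv g u))\<^sup>2 * EE u
       + GG u * deriv (deriv g) u * (\<beta>\<^sup>2 * g u - \<alpha>\<^sup>2 * u * deriv g u))"
    unfolding G''_def E'_def G'_def EE_def GG_def by algebra
  finally show ?thesis using p by (simp add: field_simps)
qed

end

section \<open>The differential equation k = 0\<close>

text \<open>
  On either side of the origin \<open>\<bar>x\<bar>\<close> is the linear function \<open>sgn(u)x\<close>.
\<close>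

lemma abs_powr_has_real_derivative:
  fixes u q :: real
  assumes "u \<noteq> 0"
  shows "((\<lambda>x. \<bar>x\<bar> powr q) has_real_derivative q * \<bar>u\<bar> powr q / u) (at u)"
proof -
  have *: "((\<lambda>x. (s * x) powr q) has_real_derivative q * \<bar>u\<bar> powr q / u) (at u)"
    if s: "s = sgn u" for s
  proof -
    have su: "s * u = \<bar>u\<bar>" "s * u > 0" "s \<noteq> 0" using s assms by (simp_all add: sgn_if)
    have "((\<lambda>x. (s * x) powr q) has_real_derivative
        (s * u) powr q * (0 * ln (s * u) + s * q / (s * u))) (at u)"
      by (rule DERIV_powr) (use su in \<open>auto intro!: derivative_eq_intros\<close>)
    moreover have "(s * u) powr q * (0 * ln (s * u) + s * q / (s * u)) = q * \<bar>u\<bar> powr q / u"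
      using su(3) by (simp add: su(1)[symmetric])
    ultimately show ?thesis by simp
  qed
  show ?thesis
  proof (cases "u > 0")
    case True
    show ?thesis
      by (rule has_field_derivative_transform_within_open[OF *, of "sgn u" "{0<..}"])
        (use True in auto)
  next
    case False
    show ?thesis
      by (rule has_field_derivative_transform_within_open[OF *, of "sgn u" "{..<0}"])
        (use False assms in auto)
  qed
qed

lemma deriv_eqI_on:
  fixes h k :: "real \<Rightarrow> real"
  assumes "open J" "u \<in> J" "\<And>x. x \<in> J \<Longrightarrow> h x = k x" "(k has_real_derivative D) (at u)"
  shows "deriv h u = D"
  by (rule DERIV_imp_deriv, rule has_field_derivative_transform_within_open[OF assms(4,1,2)])
    (simp add: assms(3))

lemma isCont_zero_closure:
  fixes h :: "real \<Rightarrow> real"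
  assumes "isCont h x" "x \<in> closure C" "\<And>y. y \<in> C \<Longrightarrow> h y = 0"
  shows "h x = 0"
proof -
  obtain s where s: "\<And>n. s n \<in> C" "s \<longlonglongrightarrow> x"
    using assms(2) unfolding closure_sequential by blast
  then have "(\<lambda>n. h (s n)) \<longlonglongrightarrow> h x" using assms(1) isCont_tendsto_compose by blast
  then show ?thesis using s(1) assms(3) LIMSEQ_unique[OF _ tendsto_const] by fastforce
qed

context rotational_graph
begin

lemma connected_J: "connected J"
  using J(2) is_interval_connected by blast

lemma affine_derivs:
  assumes "\<And>u. u \<in> J \<Longrightarrow> g u = a * u + b" "u \<in> J"
  shows "deriv g u = a" "deriv (deriv g) u = 0"
proof -
  have *: "deriv g x = a" if "x \<in> J" for x
    by (rule deriv_eqI_on[OF J(1) that assms(1)]) (auto intro!: derivative_eq_intros)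
  show "deriv g u = a" by (rule *[OF assms(2)])
  show "deriv (deriv g) u = 0"
    by (rule deriv_eqI_on[OF J(1) assms(2) *]) auto
qed

text \<open>
  The profile vanishes at 0, so the parallel at \<open>u = 0\<close> would degenerate to the origin, against
  regularity.
\<close>

lemma power_nonzero:
  assumes "is_power_profile J g \<alpha> \<beta> c" "u \<in> J"
  shows "u \<noteq> 0"
  using regular[OF assms(2)] assms unfolding is_power_profile_def by fastforce

text \<open>
  The first equation is the differential equation \<open>B = 0\<close>; the second is its derivative combined
  with it.
\<close>

lemma power_derivs:
  assumes p: "is_power_profile J g \<alpha> \<beta> c" and u: "u \<in> J"
  shows "\<alpha>\<^sup>2 * u * deriv g u = \<beta>\<^sup>2 * g u"
    and "\<alpha> ^ 4 * u\<^sup>2 * deriv (deriv g) u = \<beta>\<^sup>2 * (\<beta>\<^sup>2 - \<alpha>\<^sup>2) * g u"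
proof -
  let ?p = "\<beta>\<^sup>2 / \<alpha>\<^sup>2"
  have gx: "g x = c * \<bar>x\<bar> powr ?p" if "x \<in> J" for x
    using p that by (simp add: is_power_profile_def)
  have d: "deriv g x = ?p * g x / x" if "x \<in> J" for x
  proof (rule deriv_eqI_on[OF J(1) that gx])
    show "((\<lambda>x. c * \<bar>x\<bar> powr ?p) has_real_derivative ?p * g x / x) (at x)"
      using DERIV_cmult[OF abs_powr_has_real_derivative[OF power_nonzero[OF p that]], of c ?p]
      by (simp add: gx[OF that] mult_ac)
  qed
  note nz = power_nonzero[OF p u]
  show 1: "\<alpha>\<^sup>2 * u * deriv g u = \<beta>\<^sup>2 * g u"
    using d[OF u] nz pos by (simp add: field_simps)
  have "deriv (deriv g) u = (?p * deriv g u * u - ?p * g u) / (u * u)"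
    by (rule deriv_eqI_on[OF J(1) u d])
      (rule derivative_eq_intros g'[OF u] refl | use nz in simp)+
  then show "\<alpha> ^ 4 * u\<^sup>2 * deriv (deriv g) u = \<beta>\<^sup>2 * (\<beta>\<^sup>2 - \<alpha>\<^sup>2) * g u"
    unfolding d[OF u] using nz pos by (simp add: field_simps power2_eq_square power4_eq_xxxx)
qed

lemma affine_if_second_deriv_zero:
  assumes "\<And>u. u \<in> J \<Longrightarrow> deriv (deriv g) u = 0"
  obtains a b where "\<And>u. u \<in> J \<Longrightarrow> g u = a * u + b"
proof -
  have "deriv g constant_on J"
    using g'' assms by (intro has_field_derivative_0_imp_constant_on connected_J J(1)) fastforce
  then obtain a where a: "\<And>u. u \<in> J \<Longrightarrow> deriv g u = a" unfolding constant_on_def by blast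
  have "(\<lambda>u. g u - a * u) constant_on J"
  proof (rule has_field_derivative_0_imp_constant_on[OF _ connected_J J(1)])
    fix u assume "u \<in> J"
    from g'[OF this] a[OF this] show "((\<lambda>u. g u - a * u) has_real_derivative 0) (at u)"
      by (auto intro!: derivative_eq_intros)
  qed
  then obtain b where "\<And>u. u \<in> J \<Longrightarrow> g u - a * u = b" unfolding constant_on_def by blast
  then have "\<And>u. u \<in> J \<Longrightarrow> g u = a * u + b" by fastforce
  then show ?thesis by (rule that)
qed

text \<open>
  The set \<open>U = {g'' \<noteq> 0}\<close> is open. On it \<open>B = 0\<close>, hence also \<open>B' = 0\<close>. On the component \<open>C\<close> of
  \<open>u1\<close> the function \<open>g u * \<bar>u\<bar> powr (-\<beta>\<^sup>2/\<alpha>\<^sup>2)\<close> has derivative zero, so it is a constant \<open>c\<close>, and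
  \<open>c \<noteq> 0\<close>. These three equations persist on the closure of \<open>C\<close> in \<open>J\<close>. They determine \<open>g\<close>, \<open>g'\<close>, \<open>g''\<close>
  there successively, and all three are nonzero. So \<open>C\<close> is closed in \<open>J\<close>, and \<open>C = J\<close>.
\<close>

lemma power_if_second_deriv_nonzero:
  assumes k0: "\<And>u. u \<in> J \<Longrightarrow> (g u - u * deriv g u)\<^sup>2 * deriv (deriv g) u
        * (\<beta>\<^sup>2 * g u - \<alpha>\<^sup>2 * u * deriv g u) = 0"
    and u1: "u1 \<in> J" "deriv (deriv g) u1 \<noteq> 0"
  shows "\<exists>c. is_power_profile J g \<alpha> \<beta> c"
proof -
  define U where "U = {u \<in> J. deriv (deriv g) u \<noteq> 0}"
  define B where "B u = \<beta>\<^sup>2 * g u - \<alpha>\<^sup>2 * u * deriv g u" for u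
  have UJ: "U \<subseteq> J" by (auto simp: U_def)
  have open_nz: "open {u \<in> S. h u \<noteq> 0}" if "open S" "S \<subseteq> J" "\<And>u. u \<in> J \<Longrightarrow> isCont h u"
    for S and h :: "real \<Rightarrow> real"
  proof -
    have "continuous_on S h" using that by (auto intro: continuous_at_imp_continuous_on)
    then have "open (S \<inter> h -` (- {0}))" using that(1) by (rule continuous_open_preimage) auto
    moreover have "S \<inter> h -` (- {0}) = {u \<in> S. h u \<noteq> 0}" by auto
    ultimately show ?thesis by simp
  qed
  have open_U: "open U" unfolding U_def by (rule open_nz) (use J isCont_g'' in auto)
  have cont: "isCont g u" "isCont (deriv g) u" if "u \<in> J" for u
    using g'[OF that] g''[OF that] DERIV_isCont by blast+
  have cont_B: "isCont B u" if "u \<in> J" for u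
    unfolding B_def[abs_def] using cont[OF that] by (intro continuous_intros)
  \<comment> \<open>At the origin \<open>B = 0\<close> would give \<open>g = 0\<close>, which regularity excludes.\<close>
  have B_nonzero: "u \<noteq> 0" if "u \<in> J" "B u = 0" for u
    using that regular[OF that(1)] pos by (auto simp: B_def)
  have B0: "B u = 0" if "u \<in> U" for u
  proof (rule ccontr)
    assume "B u \<noteq> 0"
    define S where "S = {u \<in> U. B u \<noteq> 0}"
    have "open S" unfolding S_def by (rule open_nz[OF open_U UJ cont_B])
    \<comment> \<open>On \<open>S\<close> the remaining factor \<open>A\<close> vanishes, so \<open>0 = A' = -xg''\<close>, and the open set \<open>S\<close> is inside \<open>{0}\<close>.\<close>
    have "x = 0" if x: "x \<in> S" for x
    proof -
      have xJ: "x \<in> J" and nz: "deriv (deriv g) x \<noteq> 0" using x by (auto simp: S_def U_def)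
      have "deriv (\<lambda>u. g u - u * deriv g u) x = 0"
      proof (rule deriv_eqI_on[OF \<open>open S\<close> x])
        fix y assume "y \<in> S"
        then show "g y - y * deriv g y = 0" using k0[of y] by (auto simp: S_def U_def B_def)
      qed simp
      moreover have "((\<lambda>u. g u - u * deriv g u) has_real_derivative - x * deriv (deriv g) x) (at x)"
        by (rule derivative_eq_intros g'[OF xJ] g''[OF xJ] refl | simp)+
      ultimately show ?thesis using nz DERIV_imp_deriv by fastforce
    qed
    moreover have "u \<in> S" using that \<open>B u \<noteq> 0\<close> by (simp add: S_def)
    ultimately have "S = {0}" by blast
    then show False using \<open>open S\<close> not_open_singleton[of "0::real"] by simp
  qed
  have B'0: "\<alpha>\<^sup>2 * u * deriv (deriv g) u - (\<beta>\<^sup>2 - \<alpha>\<^sup>2) * deriv g u = 0" if "u \<in> U" for u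
  proof -
    have uJ: "u \<in> J" using that UJ by blast
    have "deriv B u = 0" by (rule deriv_eqI_on[OF open_U that B0]) auto
    moreover have "(B has_real_derivative
        (\<beta>\<^sup>2 - \<alpha>\<^sup>2) * deriv g u - \<alpha>\<^sup>2 * u * deriv (deriv g) u) (at u)"
      unfolding B_def[abs_def]
      by (rule derivative_eq_intros g'[OF uJ] g''[OF uJ] refl | simp add: algebra_simps)+
    ultimately show ?thesis using DERIV_imp_deriv by fastforce
  qed
  define C where "C = connected_component_set U u1"
  have "u1 \<in> U" using u1 by (simp add: U_def)
  then have u1C: "u1 \<in> C" by (simp add: C_def)
  have CU: "C \<subseteq> U" by (simp add: C_def connected_component_subset)
  have C: "open C" "connected C"
    using open_U by (simp_all add: C_def open_connected_component)
  let ?p = "\<beta>\<^sup>2 / \<alpha>\<^sup>2"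
  have "(\<lambda>u. g u * \<bar>u\<bar> powr (- ?p)) constant_on C"
  proof (rule has_field_derivative_0_imp_constant_on[OF _ C(2,1)])
    fix u assume "u \<in> C"
    then have uU: "u \<in> U" and uJ: "u \<in> J" using CU UJ by auto
    have nz: "u \<noteq> 0" using B_nonzero B0 uU uJ by blast
    have eq: "deriv g u = ?p * g u / u"
      using B0[OF uU] nz pos by (simp add: B_def field_simps)
    show "((\<lambda>u. g u * \<bar>u\<bar> powr (- ?p)) has_real_derivative 0) (at u)"
      by (rule DERIV_cong[OF DERIV_mult[OF g'[OF uJ] abs_powr_has_real_derivative[OF nz]]])
        (simp add: eq)
  qed
  then obtain c where c: "\<And>u. u \<in> C \<Longrightarrow> g u * \<bar>u\<bar> powr (- ?p) = c"
    unfolding constant_on_def by blast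
  have g_eq: "g u = c * \<bar>u\<bar> powr ?p \<longleftrightarrow> g u * \<bar>u\<bar> powr (- ?p) - c = 0" if "u \<noteq> 0" for u
    using that by (simp add: powr_minus field_simps)
  have u1nz: "u1 \<noteq> 0" using B_nonzero B0 \<open>u1 \<in> U\<close> u1 by blast
  \<comment> \<open>A power function with nonvanishing second derivative has \<open>\<alpha> \<noteq> \<beta>\<close> and \<open>c \<noteq> 0\<close>.\<close>
  have "(\<beta>\<^sup>2 - \<alpha>\<^sup>2) * deriv g u1 \<noteq> 0"
    using B'0[OF \<open>u1 \<in> U\<close>] u1 u1nz pos by auto
  then have \<beta>\<alpha>: "\<beta>\<^sup>2 - \<alpha>\<^sup>2 \<noteq> 0" and "deriv g u1 \<noteq> 0" by auto
  then have "g u1 \<noteq> 0" using B0[OF \<open>u1 \<in> U\<close>] u1nz pos by (auto simp: B_def)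
  then have c_nz: "c \<noteq> 0" using c[OF u1C] u1nz by auto
  have "u \<in> C" if u: "u \<in> J" "u \<in> closure C" for u
  proof -
    have "B u = 0" using isCont_zero_closure[OF cont_B[OF u(1)] u(2)] CU B0 by blast
    then have nz: "u \<noteq> 0" using B_nonzero u(1) by blast
    have "isCont (\<lambda>u. g u * \<bar>u\<bar> powr (- ?p) - c) u"
      using cont(1)[OF u(1)] DERIV_isCont[OF abs_powr_has_real_derivative[OF nz]]
      by (rule isCont_diff[OF isCont_mult continuous_const])
    then have "g u * \<bar>u\<bar> powr (- ?p) - c = 0"
      using u(2) by (rule isCont_zero_closure) (simp add: c)
    then have "g u \<noteq> 0" using g_eq[OF nz] nz c_nz by simp
    then have g'nz: "deriv g u \<noteq> 0" using \<open>B u = 0\<close> pos by (auto simp: B_def)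
    have "isCont (\<lambda>u. \<alpha>\<^sup>2 * u * deriv (deriv g) u - (\<beta>\<^sup>2 - \<alpha>\<^sup>2) * deriv g u) u"
      using cont[OF u(1)] isCont_g''[OF u(1)] by (intro continuous_intros)
    then have "\<alpha>\<^sup>2 * u * deriv (deriv g) u - (\<beta>\<^sup>2 - \<alpha>\<^sup>2) * deriv g u = 0"
      using u(2) by (rule isCont_zero_closure) (use CU B'0 in blast)
    then have "u \<in> U" using g'nz \<beta>\<alpha> u(1) by (auto simp: U_def)
    have "connected (insert u C)"
      by (rule connected_intermediate_closure[OF C(2)]) (use u(2) closure_subset in auto)
    then have "insert u C \<subseteq> C"
      unfolding C_def using \<open>u \<in> U\<close> CU u1C
      by (intro connected_component_maximal) (auto simp: C_def)
    then show ?thesis by simp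
  qed
  then have CJ: "C = J \<inter> closure C" using CU UJ closure_subset by blast
  have "closedin (top_of_set J) C" by (subst CJ) (simp add: closedin_closed_Int)
  moreover have "openin (top_of_set J) C"
    using C(1) CU UJ by (simp add: open_subset subset_trans)
  ultimately have "C = J" using connected_J u1C unfolding connected_clopen by blast
  have "is_power_profile J g \<alpha> \<beta> c"
    unfolding is_power_profile_def
  proof (intro conjI ballI c_nz)
    fix u assume "u \<in> J"
    then have "u \<in> C" "u \<noteq> 0" using \<open>C = J\<close> B_nonzero B0 CU by auto
    then show "g u = c * \<bar>u\<bar> powr ?p" using g_eq c by simp
  qed
  then show ?thesis by blast
qed

lemma k_numerator_zero_iff:
  "(\<forall>u\<in>J. (g u - u * deriv g u)\<^sup>2 * deriv (deriv g) u
        * (\<beta>\<^sup>2 * g u - \<alpha>\<^sup>2 * u * deriv g u) = 0) \<longleftrightarrow>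
     is_constant_profile J g \<or> (\<exists>a. is_linear_profile J g a)
     \<or> (\<exists>a b. is_affine_profile J g a b) \<or> (\<exists>c. is_power_profile J g \<alpha> \<beta> c)"
  (is "?L \<longleftrightarrow> ?R")
proof
  assume L: ?L
  show ?R
  proof (cases "\<forall>u\<in>J. deriv (deriv g) u = 0")
    case True
    obtain a b where "\<And>u. u \<in> J \<Longrightarrow> g u = a * u + b"
      by (rule affine_if_second_deriv_zero) (use True in auto)
    then show ?thesis
      unfolding is_constant_profile_def is_linear_profile_def is_affine_profile_def
      by (cases "a = 0"; cases "b = 0") auto
  next
    case False
    then obtain u1 where u1: "u1 \<in> J" "deriv (deriv g) u1 \<noteq> 0" by blast
    show ?thesis
      by (intro disjI2 power_if_second_deriv_nonzero[OF _ u1]) (rule bspec[OF L])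
  qed
next
  assume ?R
  then consider a b where "\<And>u. u \<in> J \<Longrightarrow> g u = a * u + b"
    | c where "is_power_profile J g \<alpha> \<beta> c"
    unfolding is_constant_profile_def is_linear_profile_def is_affine_profile_def
    by (metis add.right_neutral add_0 mult_zero_left)
  then show ?L
  proof cases
    case 1
    then show ?thesis using affine_derivs by simp
  next
    case 2
    then show ?thesis using power_derivs(1) by simp
  qed
qed

end

section \<open>Rulings\<close>

lemma has_vector_derivative_orthogonal:
  fixes F :: "real \<Rightarrow> 'a::real_inner"
  assumes "(F has_vector_derivative D) (at t)" "open I" "t \<in> I" "\<And>s. s \<in> I \<Longrightarrow> F s \<bullet> n = 0"
  shows "D \<bullet> n = 0"
proof -
  have "((\<lambda>s. F s \<bullet> n) has_vector_derivative D \<bullet> n) (at t)"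
    using bounded_linear_inner_left assms(1) by (rule bounded_linear.has_vector_derivative)
  moreover have "((\<lambda>s. F s \<bullet> n) has_vector_derivative 0) (at t)"
    by (rule has_vector_derivative_transform_within_open[OF has_vector_derivative_const assms(2,3)])
      (simp add: assms(4))
  ultimately show ?thesis by (rule vector_derivative_unique_at)
qed

text \<open>
  Equal affine planes have equal direction spaces, even though their base points differ: a
  direction of the second plane is a difference of two of its points.
\<close>

lemma tangent_plane_normal:
  assumes eq: "tangent_plane z p = tangent_plane z q"
    and n: "case_prod (du z) p \<bullet> n = 0" "case_prod (dv z) p \<bullet> n = 0"
  shows "case_prod (du z) q \<bullet> n = 0" "case_prod (dv z) q \<bullet> n = 0"
proof -
  let ?S = "\<lambda>q. span {case_prod (du z) q, case_prod (dv z) q}"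
  have p0: "w \<bullet> n = 0" if "w \<in> ?S p" for w
  proof -
    have "orthogonal n w"
      by (rule orthogonal_to_span[OF that]) (use n in \<open>auto simp: orthogonal_def inner_commute\<close>)
    then show ?thesis by (simp add: orthogonal_def inner_commute)
  qed
  have q0: "w \<bullet> n = 0" if w: "w \<in> ?S q" for w
  proof -
    have "case_prod z q + w \<in> tangent_plane z q" "case_prod z q + 0 \<in> tangent_plane z q"
      unfolding tangent_plane_def using w span_zero by blast+
    then have "case_prod z q + w \<in> tangent_plane z p" "case_prod z q + 0 \<in> tangent_plane z p"
      by (simp_all only: eq)
    then obtain s s' where s: "s \<in> ?S p" "s' \<in> ?S p"
      "case_prod z q + w = case_prod z p + s" "case_prod z q + 0 = case_prod z p + s'"
      unfolding tangent_plane_def by blast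
    then have "w = s - s'" by (simp add: algebra_simps)
    then show ?thesis using p0 s(1,2) by (simp add: inner_diff_left)
  qed
  show "case_prod (du z) q \<bullet> n = 0" "case_prod (dv z) q \<bullet> n = 0"
    by (simp_all add: q0 span_base)
qed

context rotational_graph
begin

definition meridians :: "real set \<Rightarrow> ((real \<Rightarrow> real \<times> real) \<times> real set) set" where
  "meridians V = (\<lambda>v. ((\<lambda>t. (t, v)), J)) ` V"

lemma swept_out_by_meridians:
  assumes g: "\<And>u. u \<in> J \<Longrightarrow> g u = a * u + b"
  shows "swept_out_by z (J \<times> V) (meridians V)"
proof -
  have "ruling z (J \<times> V) (\<lambda>t. (t, v)) J" if "v \<in> V" for v
  proof -
    let ?p = "rot_frame \<alpha> \<beta> v 0 0 b 0" and ?d = "rot_frame \<alpha> \<beta> v 1 0 a 0"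
    have "?d \<bullet> ?d \<noteq> 0" unfolding inner_rot_frame by (simp add: add_nonneg_eq_0_iff)
    then have "?d \<noteq> 0" by auto
    moreover have "z t v = ?p + t *\<^sub>R ?d" if "t \<in> J" for t
      using that by (simp add: z_eq g vec_eq_iff forall_4 rot_frame_def vector_4 algebra_simps)
    moreover have "(\<lambda>t. (t, v)) differentiable_on J"
      by (auto simp: differentiable_on_def intro!: derivative_intros)
    ultimately show ?thesis
      unfolding ruling_def using J that by fastforce
  qed
  then show ?thesis unfolding swept_out_by_def meridians_def by auto
qed

lemma linear_nonzero:
  assumes "is_linear_profile J g a" "u \<in> J"
  shows "u \<noteq> 0"
  using regular[OF assms(2)] assms unfolding is_linear_profile_def by fastforce

text \<open>
  The surface is a cone over the origin: \<open>z = u z\<^sub>u\<close> lies in the direction space, so the tangent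
  plane is a linear subspace, and along a meridian \<open>z\<^sub>v\<close> only changes its length.
\<close>

lemma linear_developable:
  assumes lin: "is_linear_profile J g a"
  shows "developable_surface z (J \<times> V)"
proof -
  have g: "g u = a * u + 0" if "u \<in> J" for u
    using lin that by (simp add: is_linear_profile_def)
  have plane: "tangent_plane z (t, v) =
      span {rot_frame \<alpha> \<beta> v 1 0 a 0, rot_frame \<alpha> \<beta> v 0 \<alpha> 0 (\<beta> * a)}" if t: "t \<in> J" for t v
  proof -
    let ?x = "rot_frame \<alpha> \<beta> v 1 0 a 0" and ?y = "rot_frame \<alpha> \<beta> v 0 \<alpha> 0 (\<beta> * a)"
    have t0: "t \<noteq> 0" using linear_nonzero[OF lin t] .
    have "dv z t v = t *\<^sub>R ?y" "z t v = t *\<^sub>R ?x" "du z t v = ?x"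
      using affine_derivs(1)[OF g t]
      by (simp_all add: dv_z z_eq du_z t g vec_eq_iff forall_4 rot_frame_def vector_4 algebra_simps)
    moreover have "span {?x, t *\<^sub>R ?y} = span {?x, ?y}"
    proof
      show "span {?x, t *\<^sub>R ?y} \<subseteq> span {?x, ?y}"
        by (rule span_minimal) (auto intro: span_base span_scale)
      have "(1 / t) *\<^sub>R (t *\<^sub>R ?y) \<in> span {?x, t *\<^sub>R ?y}" by (intro span_scale span_base) simp
      then show "span {?x, ?y} \<subseteq> span {?x, t *\<^sub>R ?y}"
        using t0 by (intro span_minimal) (auto intro: span_base)
    qed
    ultimately have "tangent_plane z (t, v) = (+) (t *\<^sub>R ?x) ` span {?x, ?y}"
      by (simp add: tangent_plane_def)
    also have "\<dots> = span {?x, ?y}"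
    proof -
      have m: "t *\<^sub>R ?x \<in> span {?x, ?y}" by (intro span_scale span_base) simp
      show ?thesis
      proof (intro equalityI subsetI)
        fix w assume "w \<in> span {?x, ?y}"
        then have "w - t *\<^sub>R ?x \<in> span {?x, ?y}" "w = t *\<^sub>R ?x + (w - t *\<^sub>R ?x)"
          using m span_diff by auto
        then show "w \<in> (+) (t *\<^sub>R ?x) ` span {?x, ?y}" by blast
      qed (use m span_add in auto)
    qed
    finally show ?thesis .
  qed
  show ?thesis
    unfolding developable_surface_def
    by (intro exI[of _ "meridians V"] conjI swept_out_by_meridians[OF g])
      (auto simp: meridians_def plane)
qed

text \<open>
  Write the ruling as \<open>\<gamma> = (x, y)\<close> and fix a parameter \<open>t0\<close> on it. The vector \<open>n\<close> with rotating-frame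
  coordinates \<open>(0, \<beta>g, 0, -\<alpha>u)\<close> at \<open>\<gamma>(t0)\<close> is normal there, hence along all of \<open>\<gamma>\<close>. Differentiating
  \<open>z\<^sub>u \<bullet> n = 0\<close> along \<open>\<gamma>\<close> at \<open>t0\<close> gives \<open>\<alpha>\<beta>b y' = 0\<close>, because \<open>z\<^sub>u\<^sub>u = 0\<close> for an affine
  profile and \<open>z\<^sub>u\<^sub>v \<bullet> n = \<alpha>\<beta>b\<close>. Then \<open>z\<^sub>v \<bullet> n = 0\<close> gives \<open>\<alpha>\<beta>b x' = 0\<close>. A curve at rest in
  the parameter plane cannot trace a segment with nonzero velocity.
\<close>

lemma affine_not_developable:
  assumes aff: "is_affine_profile J g a b" and V: "V \<noteq> {}"
  shows "\<not> developable_surface z (J \<times> V)"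
proof
  assume "developable_surface z (J \<times> V)"
  then obtain R where R: "swept_out_by z (J \<times> V) R"
    and R_const: "\<forall>(\<gamma>, I)\<in>R. \<forall>s\<in>I. \<forall>t\<in>I. tangent_plane z (\<gamma> s) = tangent_plane z (\<gamma> t)"
    unfolding developable_surface_def by (elim exE conjE)
  have "J \<times> V \<noteq> {}" using J(3) V by simp
  then have "R \<noteq> {}" using R by (auto simp: swept_out_by_def)
  then obtain \<gamma> I where RI: "(\<gamma>, I) \<in> R" by auto
  have const: "tangent_plane z (\<gamma> s) = tangent_plane z (\<gamma> t)" if "s \<in> I" "t \<in> I" for s t
    using bspec[OF R_const RI] that unfolding prod.case by blast
  have rul: "ruling z (J \<times> V) \<gamma> I"
    using R RI by (auto simp: swept_out_by_def)
  then obtain p d where I: "open I" "I \<noteq> {}" "\<gamma> differentiable_on I" "\<gamma> ` I \<subseteq> J \<times> V"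
    and d: "d \<noteq> 0" "\<forall>t\<in>I. case_prod z (\<gamma> t) = p + t *\<^sub>R d"
    unfolding ruling_def by (elim exE conjE)
  obtain t0 where t0: "t0 \<in> I" using I(2) by blast
  define x where "x = (\<lambda>t. fst (\<gamma> t))"
  define y where "y = (\<lambda>t. snd (\<gamma> t))"
  have \<gamma>: "\<gamma> t = (x t, y t)" for t by (simp add: x_def y_def)
  have xJ: "x t \<in> J" if "t \<in> I" for t using I(4) that by (auto simp: \<gamma>)
  have "\<gamma> differentiable (at t0)" using I(1,3) t0 by (simp add: differentiable_on_eq_differentiable_at)
  then obtain D where "(\<gamma> has_vector_derivative D) (at t0)"
    using vector_derivative_works[of \<gamma>] by auto
  then have x': "(x has_real_derivative fst D) (at t0)" and y': "(y has_real_derivative snd D) (at t0)"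
    unfolding x_def y_def has_real_derivative_iff_has_vector_derivative
    by (rule bounded_linear.has_vector_derivative[OF bounded_linear_fst]
        bounded_linear.has_vector_derivative[OF bounded_linear_snd])+
  have g: "g u = a * u + b" if "u \<in> J" for u using aff that by (simp add: is_affine_profile_def)
  have ab: "b \<noteq> 0" using aff by (simp add: is_affine_profile_def)
  have g1: "deriv g u = a" if "u \<in> J" for u by (rule affine_derivs(1)[OF g that])
  have gx': "((\<lambda>t. g (x t)) has_real_derivative a * fst D) (at t0)"
    using DERIV_chain2[OF g'[OF xJ[OF t0]] x'] g1[OF xJ[OF t0]] by simp
  define n where "n = rot_frame \<alpha> \<beta> (y t0) 0 (\<beta> * g (x t0)) 0 (- \<alpha> * x t0)"
  have n0: "du z (x t0) (y t0) \<bullet> n = 0" "dv z (x t0) (y t0) \<bullet> n = 0"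
    by (simp_all add: n_def du_z dv_z xJ t0 inner_rot_frame)
  have nt: "du z (x t) (y t) \<bullet> n = 0" "dv z (x t) (y t) \<bullet> n = 0" if "t \<in> I" for t
    using tangent_plane_normal[OF const[OF t0 that], of n] n0 by (simp_all add: \<gamma>)
  have zu: "rot_frame \<alpha> \<beta> (y t) 1 0 a 0 \<bullet> n = 0" if "t \<in> I" for t
    using nt(1)[OF that] by (simp add: du_z xJ that g1)
  have zv: "rot_frame \<alpha> \<beta> (y t) 0 (\<alpha> * x t) 0 (\<beta> * g (x t)) \<bullet> n = 0" if "t \<in> I" for t
    using nt(2)[OF that] by (simp add: dv_z xJ that)
  have "\<alpha> * \<beta> * b * snd D = 0"
    using has_vector_derivative_orthogonal[OF rot_frame_has_vector_derivative[OF y' DERIV_const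
        DERIV_const DERIV_const DERIV_const] I(1) t0 zu]
    by (simp add: n_def inner_rot_frame g xJ t0 algebra_simps)
  then have D2: "snd D = 0" using pos ab by simp
  have "\<alpha> * \<beta> * b * fst D = 0"
    using has_vector_derivative_orthogonal[OF rot_frame_has_vector_derivative[OF y' DERIV_const
        DERIV_cmult[OF x'] DERIV_const DERIV_cmult[OF gx']] I(1) t0 zv]
    by (simp add: n_def inner_rot_frame g xJ t0 D2 algebra_simps)
  then have D1: "fst D = 0" using pos ab by simp
  have "((\<lambda>t. rot_frame \<alpha> \<beta> (y t) (x t) 0 (g (x t)) 0) has_vector_derivative 0) (at t0)"
    by (rule has_vector_derivative_eq_rhs, rule rot_frame_has_vector_derivative[OF y' x' DERIV_const
        gx' DERIV_const])
      (simp add: D1 D2 rot_frame_def vec_eq_iff forall_4 vector_4)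
  moreover have "((\<lambda>t. rot_frame \<alpha> \<beta> (y t) (x t) 0 (g (x t)) 0) has_vector_derivative d) (at t0)"
  proof (rule has_vector_derivative_transform_within_open[OF _ I(1) t0])
    show "((\<lambda>t. p + t *\<^sub>R d) has_vector_derivative d) (at t0)"
      by (rule derivative_eq_intros refl | simp)+
    fix t assume "t \<in> I"
    then show "p + t *\<^sub>R d = rot_frame \<alpha> \<beta> (y t) (x t) 0 (g (x t)) 0"
      using d(2) by (simp add: \<gamma> z_eq xJ flip: z_eq)
  qed
  ultimately have "d = 0" by (metis vector_derivative_unique_at)
  then show False using d(1) by simp
qed

section \<open>Parametric lines\<close>

text \<open>
  The projection to the first coordinate plane is an arc of a circle of radius \<open>\<bar>u\<bar>\<close>, and three of
  its points are already not collinear.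
\<close>

lemma parallel_not_collinear:
  assumes u: "u \<in> J" "u \<noteq> 0"
  shows "\<not> collinear ((\<lambda>v. z u v) ` {0..<2 * pi})"
proof
  assume "collinear ((\<lambda>v. z u v) ` {0..<2 * pi})"
  then obtain w where w: "\<And>v v'. v \<in> {0..<2 * pi} \<Longrightarrow> v' \<in> {0..<2 * pi} \<Longrightarrow>
      \<exists>c. z u v - z u v' = c *\<^sub>R w"
    unfolding collinear_def by blast
  \<comment> \<open>The angle \<open>s = \<alpha>t\<close> is in \<open>(0, 1]\<close>, while \<open>2t\<close> stays below \<open>2\<pi>\<close>.\<close>
  define t where "t = min 1 (1 / \<alpha>)"
  define s where "s = \<alpha> * t"
  have t: "t > 0" "t \<le> 1" using pos by (simp_all add: t_def)
  have s: "s > 0" "s \<le> 1" using pos t(1) by (auto simp: s_def t_def min_def field_simps)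
  have dom: "0 \<in> {0..<2 * pi}" "t \<in> {0..<2 * pi}" "2 * t \<in> {0..<2 * pi}"
    using t pi_gt3 by auto
  obtain c1 c2 where c: "z u t - z u 0 = c1 *\<^sub>R w" "z u (2 * t) - z u 0 = c2 *\<^sub>R w"
    using w dom by meson
  have "u * (cos s - 1) = c1 * w $ 1" "u * sin s = c1 * w $ 2"
    using arg_cong[OF c(1), of "\<lambda>x. x $ 1"] arg_cong[OF c(1), of "\<lambda>x. x $ 2"]
    by (simp_all add: z_eq u(1) rot_frame_def vector_4 s_def algebra_simps)
  moreover have "u * (cos (2 * s) - 1) = c2 * w $ 1" "u * sin (2 * s) = c2 * w $ 2"
    using arg_cong[OF c(2), of "\<lambda>x. x $ 1"] arg_cong[OF c(2), of "\<lambda>x. x $ 2"]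
    by (simp_all add: z_eq u(1) rot_frame_def vector_4 s_def algebra_simps)
  ultimately have "u\<^sup>2 * ((cos s - 1) * sin (2 * s) - sin s * (cos (2 * s) - 1)) = 0"
    by algebra
  moreover have "(cos s - 1) * sin (2 * s) - sin s * (cos (2 * s) - 1) = 2 * sin s * (1 - cos s)"
  proof -
    have "(sin s)\<^sup>2 = 1 - (cos s)\<^sup>2" by (simp add: sin_squared_eq)
    then show ?thesis unfolding sin_double cos_double by algebra
  qed
  ultimately have "sin s * (1 - cos s) = 0" using u(2) by simp
  moreover have "sin s > 0" using s pi_gt3 by (intro sin_gt_zero) auto
  moreover have "cos s < cos 0" using s pi_gt3 by (intro cos_monotone_0_pi) auto
  ultimately show False by simp
qed

text \<open>
  For fixed \<open>v\<close> the meridian is congruent to the graph of \<open>g\<close>; if it lies on a line, then \<open>g\<close> is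
  affine.
\<close>

lemma meridian_not_collinear:
  assumes u0: "u0 \<in> J" and nz: "deriv (deriv g) u0 \<noteq> 0"
  shows "\<not> collinear ((\<lambda>u. z u v) ` J)"
proof
  assume "collinear ((\<lambda>u. z u v) ` J)"
  then obtain w where w: "\<And>u. u \<in> J \<Longrightarrow> \<exists>c. z u v - z u0 v = c *\<^sub>R w"
    unfolding collinear_def using u0 by blast
  let ?a = "rot_frame \<alpha> \<beta> v 1 0 0 0" and ?b = "rot_frame \<alpha> \<beta> v 0 0 1 0"
  have ua: "z u v \<bullet> ?a = u" "z u v \<bullet> ?b = g u" if "u \<in> J" for u
    using that by (simp_all add: z_eq inner_rot_frame)
  have c: "\<exists>c. u - u0 = c * (w \<bullet> ?a) \<and> g u - g u0 = c * (w \<bullet> ?b)" if u: "u \<in> J" for u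
  proof -
    obtain c where c: "z u v - z u0 v = c *\<^sub>R w" using w[OF u] by blast
    show ?thesis
      using arg_cong[OF c, of "\<lambda>x. x \<bullet> ?a"] arg_cong[OF c, of "\<lambda>x. x \<bullet> ?b"]
      by (auto simp: inner_diff_left ua u u0)
  qed
  have "\<not> J \<subseteq> {u0}" using J(1) u0 not_open_singleton[of u0] by (metis subset_singletonD empty_iff)
  then obtain u1 where "u1 \<in> J" "u1 \<noteq> u0" by blast
  then have wa: "w \<bullet> ?a \<noteq> 0" using c[of u1] by auto
  define m where "m = (w \<bullet> ?b) / (w \<bullet> ?a)"
  have "g u = m * u + (g u0 - m * u0)" if "u \<in> J" for u
  proof -
    obtain k where k: "u - u0 = k * (w \<bullet> ?a)" "g u - g u0 = k * (w \<bullet> ?b)" using c[OF \<open>u \<in> J\<close>] by blast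
    have "m * (u - u0) = g u - g u0" unfolding k m_def using wa by simp
    then show ?thesis by (simp add: algebra_simps)
  qed
  then have "deriv (deriv g) u0 = 0" using affine_derivs(2) u0 by blast
  then show False using nz by simp
qed

section \<open>The three families\<close>

text \<open>
  With \<open>P = \<bar>u\<bar> powr (\<beta>\<^sup>2/\<alpha>\<^sup>2)\<close>, all powers that occur are \<open>P\<^sup>2\<close> and \<open>P\<^sup>2/u\<^sup>2\<close>, and \<open>g\<close>, \<open>g'\<close>,
  \<open>g''\<close> are rational in \<open>P\<close> and \<open>u\<close>. Since \<open>B = 0\<close>, only one of the two terms survives in each
  of the general formulas for \<open>\<kappa>\<close> and \<open>K\<close>.
\<close>

lemma power_invariants:
  assumes p: "is_power_profile J g \<alpha> \<beta> c" and u: "u \<in> J"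
  defines "G \<equiv> \<alpha>\<^sup>2 * u\<^sup>2 + \<beta>\<^sup>2 * c\<^sup>2 * \<bar>u\<bar> powr (2 * (\<beta>\<^sup>2 / \<alpha>\<^sup>2))"
    and "E \<equiv> 1 + c\<^sup>2 * (\<beta> ^ 4 / \<alpha> ^ 4) * \<bar>u\<bar> powr (2 * ((\<beta>\<^sup>2 - \<alpha>\<^sup>2) / \<alpha>\<^sup>2))"
  shows "oriented_normal_frame z e1 e2 u v \<Longrightarrow> inv_kappa z e1 e2 u v =
      c\<^sup>2 * \<alpha> powi (-5) * \<beta> ^ 3 * (\<beta>\<^sup>2 - \<alpha>\<^sup>2)\<^sup>2
        * \<bar>u\<bar> powr (2 * ((\<beta>\<^sup>2 - \<alpha>\<^sup>2) / \<alpha>\<^sup>2)) / (G * E\<^sup>2)"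
    and "gauss_curvature z u v =
      - (c\<^sup>2 * \<alpha> powi (-2) * \<beta>\<^sup>2 * (\<beta>\<^sup>2 - \<alpha>\<^sup>2)\<^sup>2 * \<bar>u\<bar> powr (2 * (\<beta>\<^sup>2 / \<alpha>\<^sup>2))) / (G\<^sup>2 * E)"
    and "G > 0" and "E > 0"
proof -
  note nz = power_nonzero[OF p u]
  define P where "P = \<bar>u\<bar> powr (\<beta>\<^sup>2 / \<alpha>\<^sup>2)"
  have P2: "\<bar>u\<bar> powr (2 * (\<beta>\<^sup>2 / \<alpha>\<^sup>2)) = P\<^sup>2"
    unfolding P_def power2_eq_square by (simp flip: powr_add)
  have e: "2 * ((\<beta>\<^sup>2 - \<alpha>\<^sup>2) / \<alpha>\<^sup>2) = 2 * (\<beta>\<^sup>2 / \<alpha>\<^sup>2) - 2"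
    using pos by (simp add: field_simps)
  have P2': "\<bar>u\<bar> powr (2 * ((\<beta>\<^sup>2 - \<alpha>\<^sup>2) / \<alpha>\<^sup>2)) = P\<^sup>2 / u\<^sup>2"
    unfolding e powr_diff P2 using nz by simp
  have g: "g u = c * P" using p u by (simp add: is_power_profile_def P_def)
  have g1: "deriv g u = \<beta>\<^sup>2 * c * P / (\<alpha>\<^sup>2 * u)"
    using power_derivs(1)[OF p u] nz pos by (simp add: g field_simps)
  have g2: "deriv (deriv g) u = \<beta>\<^sup>2 * (\<beta>\<^sup>2 - \<alpha>\<^sup>2) * c * P / (\<alpha> ^ 4 * u\<^sup>2)"
    using power_derivs(2)[OF p u] nz pos by (simp add: g field_simps)
  have B: "\<beta>\<^sup>2 * g u - \<alpha>\<^sup>2 * u * deriv g u = 0" using power_derivs(1)[OF p u] by simp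
  have A: "u * deriv g u - g u = (\<beta>\<^sup>2 - \<alpha>\<^sup>2) * c * P / \<alpha>\<^sup>2"
    unfolding g1 g using nz pos by (simp add: field_simps)
  have G: "GG u = G" unfolding GG_def G_def g P2 by (simp add: power_mult_distrib)
  have E: "EE u = E" unfolding EE_def E_def g1 P2' by (simp add: power_mult_distrib power_divide)
  show "G > 0" "E > 0" using GG_pos[OF u] EE_pos[of u] by (simp_all add: G E)
  then have ne: "G \<noteq> 0" "E \<noteq> 0" by auto
  have inv5: "\<alpha> powi (-5) = 1 / \<alpha> ^ 5" and inv2: "\<alpha> powi (-2) = 1 / \<alpha>\<^sup>2"
    by (simp_all add: power_int_def field_simps)
  show "inv_kappa z e1 e2 u v =
      c\<^sup>2 * \<alpha> powi (-5) * \<beta> ^ 3 * (\<beta>\<^sup>2 - \<alpha>\<^sup>2)\<^sup>2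
        * \<bar>u\<bar> powr (2 * ((\<beta>\<^sup>2 - \<alpha>\<^sup>2) / \<alpha>\<^sup>2)) / (G * E\<^sup>2)"
    if "oriented_normal_frame z e1 e2 u v"
    unfolding inv_kappa_formula[OF u that] A B g2 G E P2' inv5
    using ne nz pos by (simp add: divide_simps) algebra
  have A': "g u - u * deriv g u = - ((\<beta>\<^sup>2 - \<alpha>\<^sup>2) * c * P / \<alpha>\<^sup>2)" using A by simp
  show "gauss_curvature z u v =
      - (c\<^sup>2 * \<alpha> powi (-2) * \<beta>\<^sup>2 * (\<beta>\<^sup>2 - \<alpha>\<^sup>2)\<^sup>2 * \<bar>u\<bar> powr (2 * (\<beta>\<^sup>2 / \<alpha>\<^sup>2))) / (G\<^sup>2 * E)"
    unfolding gauss_curvature_eq[OF u] A' B G E P2 inv2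
    using ne nz pos by (simp add: divide_simps) algebra
qed

lemma affine_invariants:
  assumes g: "\<And>u. u \<in> J \<Longrightarrow> g u = a * u + b" and u: "u \<in> J"
  shows "oriented_normal_frame z e1 e2 u v \<Longrightarrow> inv_kappa z e1 e2 u v =
      - (\<alpha> * \<beta> * b * (a * (\<beta>\<^sup>2 - \<alpha>\<^sup>2) * u + \<beta>\<^sup>2 * b)) / ((1 + a\<^sup>2) * (GG u)\<^sup>2)"
    and "gauss_curvature z u v = - (\<alpha> * \<beta> * b)\<^sup>2 / ((1 + a\<^sup>2) * (GG u)\<^sup>2)"
proof -
  have g1: "deriv g u = a" and g2: "deriv (deriv g) u = 0" using affine_derivs[OF g u] by auto
  have E: "EE u = 1 + a\<^sup>2" by (simp add: EE_def g1)
  have A: "u * a - g u = - b" "g u - u * a = b" by (simp_all add: g u)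
  have B: "\<beta>\<^sup>2 * g u - \<alpha>\<^sup>2 * u * a = a * (\<beta>\<^sup>2 - \<alpha>\<^sup>2) * u + \<beta>\<^sup>2 * b"
    by (simp add: g u algebra_simps)
  have ne: "EE u \<noteq> 0" "GG u \<noteq> 0" using EE_pos[of u] GG_pos[OF u] by auto
  show "inv_kappa z e1 e2 u v =
      - (\<alpha> * \<beta> * b * (a * (\<beta>\<^sup>2 - \<alpha>\<^sup>2) * u + \<beta>\<^sup>2 * b)) / ((1 + a\<^sup>2) * (GG u)\<^sup>2)"
    if "oriented_normal_frame z e1 e2 u v"
    unfolding inv_kappa_formula[OF u that] g1 g2 A B E[symmetric]
    using ne by (simp add: field_simps power2_eq_square)
  show "gauss_curvature z u v = - (\<alpha> * \<beta> * b)\<^sup>2 / ((1 + a\<^sup>2) * (GG u)\<^sup>2)"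
    unfolding gauss_curvature_eq[OF u] g1 g2 A E[symmetric]
    using ne by (simp add: field_simps power2_eq_square)
qed

text \<open>
  The numerator of \<open>\<kappa>\<close> is affine in \<open>u\<close> with nonzero constant term. It can vanish at one
  parameter, but not on an interval.
\<close>

lemma affine_kappa_factor_nonzero:
  assumes "b \<noteq> 0"
  shows "\<exists>u\<in>J. a * (\<beta>\<^sup>2 - \<alpha>\<^sup>2) * u + \<beta>\<^sup>2 * b \<noteq> 0"
proof (rule ccontr)
  let ?m = "a * (\<beta>\<^sup>2 - \<alpha>\<^sup>2)"
  assume "\<not> ?thesis"
  then have zero: "?m * u + \<beta>\<^sup>2 * b = 0" if "u \<in> J" for u using that by blast
  obtain u0 where u0: "u0 \<in> J" using J(3) by blast
  have "\<beta>\<^sup>2 * b \<noteq> 0" using pos assms by simp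
  then have "?m \<noteq> 0" using zero[OF u0] by auto
  have "u = u0" if "u \<in> J" for u
  proof -
    have "?m * u = ?m * u0" using zero[OF u0] zero[OF that] by linarith
    then show ?thesis using \<open>?m \<noteq> 0\<close> by (simp only: mult_cancel_left) simp
  qed
  then have "J = {u0}" using u0 by blast
  then show False using J(1) not_open_singleton[of u0] by simp
qed

end

theorem mainTheorem8:
  fixes J :: "real set" and f g :: "real \<Rightarrow> real" and \<alpha> \<beta> :: real
    and z e1 e2 :: "real \<Rightarrow> real \<Rightarrow> real^4" and V :: "real set"
  assumes J: "open J" "is_interval J" "J \<noteq> {}"
    and V: "V = {0..<2 * pi}"
    and smooth: "smooth_on J f" "smooth_on J g"
    and pos: "\<alpha> > 0" "\<beta> > 0"
    and regular: "\<And>u. u \<in> J \<Longrightarrow> \<alpha>\<^sup>2 * (f u)\<^sup>2 + \<beta>\<^sup>2 * (g u)\<^sup>2 > 0"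
      "\<And>u. u \<in> J \<Longrightarrow> (deriv f u)\<^sup>2 + (deriv g u)\<^sup>2 > 0"
    and z: "z = rotational_surface f g \<alpha> \<beta>"
    and meridian: "\<And>u. u \<in> J \<Longrightarrow> f u = u"
    and frame: "\<And>u v. u \<in> J \<Longrightarrow> v \<in> V \<Longrightarrow> oriented_normal_frame z e1 e2 u v"
  shows
    "(\<forall>u\<in>J. \<forall>v\<in>V. inv_k z e1 e2 u v =
        4 * \<alpha>\<^sup>2 * \<beta>\<^sup>2 * (g u - u * deriv g u)\<^sup>2 * deriv (deriv g) u
          * (\<beta>\<^sup>2 * g u - \<alpha>\<^sup>2 * u * deriv g u)
        / ((\<alpha>\<^sup>2 * u\<^sup>2 + \<beta>\<^sup>2 * (g u)\<^sup>2) ^ 3 * (1 + (deriv g u)\<^sup>2) ^ 3))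
   \<and> ((\<forall>u\<in>J. \<forall>v\<in>V. inv_k z e1 e2 u v = 0) \<longleftrightarrow>
        is_constant_profile J g
        \<or> (\<exists>a. is_linear_profile J g a)
        \<or> (\<exists>a b. is_affine_profile J g a b)
        \<or> (\<exists>c. is_power_profile J g \<alpha> \<beta> c))
   \<and> (\<forall>a. is_linear_profile J g a \<longrightarrow>
        (\<forall>u\<in>J. \<forall>v\<in>V. inv_k z e1 e2 u v = 0 \<and> inv_kappa z e1 e2 u v = 0
                       \<and> gauss_curvature z u v = 0)
        \<and> developable_surface z (J \<times> V))
   \<and> (\<forall>a b. is_affine_profile J g a b \<longrightarrow>
        (\<forall>u\<in>J. \<forall>v\<in>V. inv_k z e1 e2 u v = 0)
        \<and> \<not> (\<forall>u\<in>J. \<forall>v\<in>V. inv_kappa z e1 e2 u v = 0)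
        \<and> (\<forall>u\<in>J. \<forall>v\<in>V. inv_kappa z e1 e2 u v \<noteq> 0
                          \<longleftrightarrow> a * (\<beta>\<^sup>2 - \<alpha>\<^sup>2) * u + \<beta>\<^sup>2 * b \<noteq> 0)
        \<and> (\<forall>u\<in>J. \<forall>v\<in>V. gauss_curvature z u v \<noteq> 0)
        \<and> ruled_surface z (J \<times> V) \<and> \<not> developable_surface z (J \<times> V))
   \<and> (\<forall>c. is_power_profile J g \<alpha> \<beta> c \<and> \<alpha> \<noteq> \<beta> \<longrightarrow>
        (\<forall>u\<in>J. \<forall>v\<in>V.
           inv_k z e1 e2 u v = 0
           \<and> inv_kappa z e1 e2 u v =
               c\<^sup>2 * \<alpha> powi (-5) * \<beta> ^ 3 * (\<beta>\<^sup>2 - \<alpha>\<^sup>2)\<^sup>2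
                 * \<bar>u\<bar> powr (2 * ((\<beta>\<^sup>2 - \<alpha>\<^sup>2) / \<alpha>\<^sup>2))
               / ((\<alpha>\<^sup>2 * u\<^sup>2 + \<beta>\<^sup>2 * c\<^sup>2 * \<bar>u\<bar> powr (2 * (\<beta>\<^sup>2 / \<alpha>\<^sup>2)))
                  * (1 + c\<^sup>2 * (\<beta> ^ 4 / \<alpha> ^ 4) * \<bar>u\<bar> powr (2 * ((\<beta>\<^sup>2 - \<alpha>\<^sup>2) / \<alpha>\<^sup>2)))\<^sup>2)
           \<and> gauss_curvature z u v =
               - (c\<^sup>2 * \<alpha> powi (-2) * \<beta>\<^sup>2 * (\<beta>\<^sup>2 - \<alpha>\<^sup>2)\<^sup>2
                   * \<bar>u\<bar> powr (2 * (\<beta>\<^sup>2 / \<alpha>\<^sup>2)))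
               / ((\<alpha>\<^sup>2 * u\<^sup>2 + \<beta>\<^sup>2 * c\<^sup>2 * \<bar>u\<bar> powr (2 * (\<beta>\<^sup>2 / \<alpha>\<^sup>2)))\<^sup>2
                  * (1 + c\<^sup>2 * (\<beta> ^ 4 / \<alpha> ^ 4) * \<bar>u\<bar> powr (2 * ((\<beta>\<^sup>2 - \<alpha>\<^sup>2) / \<alpha>\<^sup>2))))
           \<and> inv_kappa z e1 e2 u v \<noteq> 0
           \<and> gauss_curvature z u v \<noteq> 0)
        \<and> (\<forall>u\<in>J. \<not> collinear ((\<lambda>v. z u v) ` V))
        \<and> (\<forall>v\<in>V. \<not> collinear ((\<lambda>u. z u v) ` J)))"
proof -
  interpret rotational_graph J f g \<alpha> \<beta> z
    using J smooth(2) pos regular(1) z meridian by unfold_locales auto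
  have k_eq: "inv_k z e1 e2 u v =
        4 * \<alpha>\<^sup>2 * \<beta>\<^sup>2 * (g u - u * deriv g u)\<^sup>2 * deriv (deriv g) u
          * (\<beta>\<^sup>2 * g u - \<alpha>\<^sup>2 * u * deriv g u)
        / ((\<alpha>\<^sup>2 * u\<^sup>2 + \<beta>\<^sup>2 * (g u)\<^sup>2) ^ 3 * (1 + (deriv g u)\<^sup>2) ^ 3)"
    if "u \<in> J" "v \<in> V" for u v
    using inv_k_formula[OF that(1) frame[OF that]] by (simp add: EE_def GG_def)
  have k_zero: "inv_k z e1 e2 u v = 0 \<longleftrightarrow> (g u - u * deriv g u)\<^sup>2 * deriv (deriv g) u
        * (\<beta>\<^sup>2 * g u - \<alpha>\<^sup>2 * u * deriv g u) = 0" if "u \<in> J" "v \<in> V" for u v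
    using inv_k_formula[OF that(1) frame[OF that]] pos EE_pos[of u] GG_pos[OF that(1)] by simp
  have V0: "0 \<in> V" using V by simp
  then have Vne: "V \<noteq> {}" by blast
  have k_iff: "(\<forall>u\<in>J. \<forall>v\<in>V. inv_k z e1 e2 u v = 0) \<longleftrightarrow>
      (\<forall>u\<in>J. (g u - u * deriv g u)\<^sup>2 * deriv (deriv g) u
        * (\<beta>\<^sup>2 * g u - \<alpha>\<^sup>2 * u * deriv g u) = 0)"
    using k_zero V0 by blast
  note k_iff' = k_iff[unfolded k_numerator_zero_iff]
  have "inv_k z e1 e2 u v = 0 \<and> inv_kappa z e1 e2 u v = 0 \<and> gauss_curvature z u v = 0"
    if lin: "is_linear_profile J g a" and uv: "u \<in> J" "v \<in> V" for a u v
  proof -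
    have g: "g u = a * u + 0" if "u \<in> J" for u
      using lin that by (simp add: is_linear_profile_def)
    have "inv_k z e1 e2 u v = 0" using k_iff' lin uv by blast
    moreover have "inv_kappa z e1 e2 u v = 0"
      using affine_invariants(1)[OF g uv(1) frame[OF uv]] by simp
    moreover have "gauss_curvature z u v = 0"
      using affine_invariants(2)[OF g uv(1)] by simp
    ultimately show ?thesis by blast
  qed
  then have linear_case: "(\<forall>u\<in>J. \<forall>v\<in>V. inv_k z e1 e2 u v = 0 \<and> inv_kappa z e1 e2 u v = 0
                       \<and> gauss_curvature z u v = 0)
        \<and> developable_surface z (J \<times> V)" if "is_linear_profile J g a" for a
    using that linear_developable[OF that] by blast
  have affine_case: "(\<forall>u\<in>J. \<forall>v\<in>V. inv_k z e1 e2 u v = 0)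
        \<and> \<not> (\<forall>u\<in>J. \<forall>v\<in>V. inv_kappa z e1 e2 u v = 0)
        \<and> (\<forall>u\<in>J. \<forall>v\<in>V. inv_kappa z e1 e2 u v \<noteq> 0
                          \<longleftrightarrow> a * (\<beta>\<^sup>2 - \<alpha>\<^sup>2) * u + \<beta>\<^sup>2 * b \<noteq> 0)
        \<and> (\<forall>u\<in>J. \<forall>v\<in>V. gauss_curvature z u v \<noteq> 0)
        \<and> ruled_surface z (J \<times> V) \<and> \<not> developable_surface z (J \<times> V)"
    if aff: "is_affine_profile J g a b" for a b
  proof -
    have g: "g u = a * u + b" if "u \<in> J" for u using aff that by (simp add: is_affine_profile_def)
    have b: "b \<noteq> 0" using aff by (simp add: is_affine_profile_def)
    have ne: "1 + a\<^sup>2 \<noteq> 0" by (metis add_pos_nonneg less_irrefl zero_le_power2 zero_less_one)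
    have G: "GG u \<noteq> 0" if "u \<in> J" for u using GG_pos[OF that] by simp
    have k: "\<forall>u\<in>J. \<forall>v\<in>V. inv_k z e1 e2 u v = 0" using k_iff' aff by blast
    have kap: "\<forall>u\<in>J. \<forall>v\<in>V. inv_kappa z e1 e2 u v \<noteq> 0
                          \<longleftrightarrow> a * (\<beta>\<^sup>2 - \<alpha>\<^sup>2) * u + \<beta>\<^sup>2 * b \<noteq> 0"
    proof (intro ballI)
      fix u v assume uv: "u \<in> J" "v \<in> V"
      show "inv_kappa z e1 e2 u v \<noteq> 0 \<longleftrightarrow> a * (\<beta>\<^sup>2 - \<alpha>\<^sup>2) * u + \<beta>\<^sup>2 * b \<noteq> 0"
        using affine_invariants(1)[OF g uv(1) frame[OF uv]] b ne G[OF uv(1)] pos by simp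
    qed
    have K: "\<forall>u\<in>J. \<forall>v\<in>V. gauss_curvature z u v \<noteq> 0"
    proof (intro ballI)
      fix u v assume "u \<in> J" "v \<in> V"
      show "gauss_curvature z u v \<noteq> 0"
        using affine_invariants(2)[OF g \<open>u \<in> J\<close>] b ne G[OF \<open>u \<in> J\<close>] pos by simp
    qed
    have "ruled_surface z (J \<times> V)"
      unfolding ruled_surface_def using swept_out_by_meridians[OF g] by blast
    moreover have "\<not> (\<forall>u\<in>J. \<forall>v\<in>V. inv_kappa z e1 e2 u v = 0)"
      using affine_kappa_factor_nonzero[OF b, of a] kap V0 by blast
    ultimately show ?thesis
      using k kap K affine_not_developable[OF aff Vne] by blast
  qed
  have power_case: "(\<forall>u\<in>J. \<forall>v\<in>V.
           inv_k z e1 e2 u v = 0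
           \<and> inv_kappa z e1 e2 u v =
               c\<^sup>2 * \<alpha> powi (-5) * \<beta> ^ 3 * (\<beta>\<^sup>2 - \<alpha>\<^sup>2)\<^sup>2
                 * \<bar>u\<bar> powr (2 * ((\<beta>\<^sup>2 - \<alpha>\<^sup>2) / \<alpha>\<^sup>2))
               / ((\<alpha>\<^sup>2 * u\<^sup>2 + \<beta>\<^sup>2 * c\<^sup>2 * \<bar>u\<bar> powr (2 * (\<beta>\<^sup>2 / \<alpha>\<^sup>2)))
                  * (1 + c\<^sup>2 * (\<beta> ^ 4 / \<alpha> ^ 4) * \<bar>u\<bar> powr (2 * ((\<beta>\<^sup>2 - \<alpha>\<^sup>2) / \<alpha>\<^sup>2)))\<^sup>2)
           \<and> gauss_curvature z u v =
               - (c\<^sup>2 * \<alpha> powi (-2) * \<beta>\<^sup>2 * (\<beta>\<^sup>2 - \<alpha>\<^sup>2)\<^sup>2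
                   * \<bar>u\<bar> powr (2 * (\<beta>\<^sup>2 / \<alpha>\<^sup>2)))
               / ((\<alpha>\<^sup>2 * u\<^sup>2 + \<beta>\<^sup>2 * c\<^sup>2 * \<bar>u\<bar> powr (2 * (\<beta>\<^sup>2 / \<alpha>\<^sup>2)))\<^sup>2
                  * (1 + c\<^sup>2 * (\<beta> ^ 4 / \<alpha> ^ 4) * \<bar>u\<bar> powr (2 * ((\<beta>\<^sup>2 - \<alpha>\<^sup>2) / \<alpha>\<^sup>2))))
           \<and> inv_kappa z e1 e2 u v \<noteq> 0
           \<and> gauss_curvature z u v \<noteq> 0)
        \<and> (\<forall>u\<in>J. \<not> collinear ((\<lambda>v. z u v) ` V))
        \<and> (\<forall>v\<in>V. \<not> collinear ((\<lambda>u. z u v) ` J))"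
    if "is_power_profile J g \<alpha> \<beta> c \<and> \<alpha> \<noteq> \<beta>" for c
  proof (intro conjI ballI)
    have p: "is_power_profile J g \<alpha> \<beta> c" and "\<alpha> \<noteq> \<beta>" using that by auto
    then have c: "c \<noteq> 0" by (simp add: is_power_profile_def)
    have ab: "\<beta>\<^sup>2 - \<alpha>\<^sup>2 \<noteq> 0" using \<open>\<alpha> \<noteq> \<beta>\<close> pos by (simp add: power2_eq_iff)
    {
      fix u v assume uv: "u \<in> J" "v \<in> V"
      note nz = power_nonzero[OF p uv(1)]
      note P = power_invariants[OF p uv(1)]
      show "inv_k z e1 e2 u v = 0" using k_iff' p uv by blast
      show "inv_kappa z e1 e2 u v =
               c\<^sup>2 * \<alpha> powi (-5) * \<beta> ^ 3 * (\<beta>\<^sup>2 - \<alpha>\<^sup>2)\<^sup>2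
                 * \<bar>u\<bar> powr (2 * ((\<beta>\<^sup>2 - \<alpha>\<^sup>2) / \<alpha>\<^sup>2))
               / ((\<alpha>\<^sup>2 * u\<^sup>2 + \<beta>\<^sup>2 * c\<^sup>2 * \<bar>u\<bar> powr (2 * (\<beta>\<^sup>2 / \<alpha>\<^sup>2)))
                  * (1 + c\<^sup>2 * (\<beta> ^ 4 / \<alpha> ^ 4) * \<bar>u\<bar> powr (2 * ((\<beta>\<^sup>2 - \<alpha>\<^sup>2) / \<alpha>\<^sup>2)))\<^sup>2)"
        by (rule P(1)[OF frame[OF uv]])
      show "gauss_curvature z u v =
               - (c\<^sup>2 * \<alpha> powi (-2) * \<beta>\<^sup>2 * (\<beta>\<^sup>2 - \<alpha>\<^sup>2)\<^sup>2
                   * \<bar>u\<bar> powr (2 * (\<beta>\<^sup>2 / \<alpha>\<^sup>2)))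
               / ((\<alpha>\<^sup>2 * u\<^sup>2 + \<beta>\<^sup>2 * c\<^sup>2 * \<bar>u\<bar> powr (2 * (\<beta>\<^sup>2 / \<alpha>\<^sup>2)))\<^sup>2
                  * (1 + c\<^sup>2 * (\<beta> ^ 4 / \<alpha> ^ 4) * \<bar>u\<bar> powr (2 * ((\<beta>\<^sup>2 - \<alpha>\<^sup>2) / \<alpha>\<^sup>2))))"
        by (rule P(2))
      show "inv_kappa z e1 e2 u v \<noteq> 0"
        unfolding P(1)[OF frame[OF uv]] divide_eq_0_iff mult_eq_0_iff de_Morgan_disj
        using P(3,4) c ab pos nz by (auto simp: power_int_eq_0_iff)
      show "gauss_curvature z u v \<noteq> 0"
        unfolding P(2) divide_eq_0_iff mult_eq_0_iff neg_equal_0_iff_equal de_Morgan_disj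
        using P(3,4) c ab pos nz by (auto simp: power_int_eq_0_iff)
    }
    show "\<not> collinear ((\<lambda>v. z u v) ` V)" if "u \<in> J" for u
      unfolding V using that power_nonzero[OF p that] by (rule parallel_not_collinear)
    show "\<not> collinear ((\<lambda>u. z u v) ` J)" for v
    proof -
      obtain u0 where u0: "u0 \<in> J" using J(3) by blast
      have "g u0 \<noteq> 0" using p u0 c power_nonzero[OF p u0] by (simp add: is_power_profile_def)
      then have "deriv (deriv g) u0 \<noteq> 0"
        using power_derivs(2)[OF p u0] ab pos by auto
      then show ?thesis using u0 by (intro meridian_not_collinear)
    qed
  qed
  show ?thesis
    by (intro conjI allI impI)
      (use k_eq k_iff' linear_case affine_case power_case in blast)+
qed

end
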